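(* Consider a project (as defined in the context) satisfying: (PCLI1) $g(x,z)>0$ for every $x\in\mathsf X$ and $z\in\overline{\mathbb R}$; (PCLI2) the MP index $m(x)=f(x,x)/g(x,x)$ is nondecreasing and continuous on $\mathsf X$. Assume further that at least one of the following holds: (A) for each state $x\in\mathsf X$, $G(x,\cdot)=\sum_{i\in N(x)}G_i(x)1_{S_i(x)}(\cdot)$ on $\mathbb R$, where $\{S_i(x):i\in N(x)\}$ is a countable partition of $\mathbb R$ with each $S_i(x)$ being either a left-semiclosed interval or a singleton (and $G_i(x)$ are constants); (B) for each state $x\in\mathsf X$ there is a countable set $D(x)$ giving the endpoints of a partition of $\mathbb R$ into left-semiclosed intervals or singletons, such that $\mathsf P_x^z\{\{X_t\}_{t=0}^\infty\subseteq D(x)\}=1$ for any threshold $z$. Then, for every $x\in\mathsf X$ and all $-\infty<z_1<z_2<\infty$, $$F(x,z_2)-F(x,z_1)=\int_{(z_1,z_2]}m(z)\,G(x,dz).$$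
   Context: Project model. $\mathsf X=\{x\in\mathbb R:\ell\le x\le u\}$ with $-\infty\le\ell<u\le\infty$; all sets and functions are Borel measurable. A project has state $X_t\in\mathsf X$ and action $A_t\in\{0,1\}$ ($1$ = active, $0$ = passive) at times $t=0,1,\dots$. When $(X_t,A_t)=(x,a)$ it yields reward $r(x,a)$, consumes $c(x,a)$ units of a resource, and $X_{t+1}\sim\kappa^a(x,\cdot)$, with $\kappa^0,\kappa^1$ Markov transition kernels on $\mathsf X$. The discount factor is $\beta\in[0,1)$. Standing assumption: for each $a\in\{0,1\}$, $r(\cdot,a)$ and $c(\cdot,a)$ are continuous on $\mathsf X$, $0\le c(x,0)<c(x,1)$ for all $x$, and there are a function $w:\mathsf X\to[1,\infty)$ and constants $M>0$, $\beta\le\gamma<1$ with $\max\{|r(x,a)|,c(x,a)\}\le M w(x)$ and $\beta\int w(y)\,\kappa^a(x,dy)\le\gamma w(x)$ for all $x,a$. Policies and metrics. For a nonanticipative policy $\pi$ and $X_0=x$, $F(x,\pi)=\mathsf E_x^\pi[\sum_{t\ge0}\beta^t r(X_t,A_t)]$, $G(x,\pi)=\mathsf E_x^\pi[\sum_{t\ge0}\beta^t c(X_t,A_t)]$. For $z\in\overline{\mathbb R}=\mathbb R\cup\{-\infty,\infty\}$ the $z$-policy takes $A_t=1$ iff $X_t>z$; its metrics are $F(x,z),G(x,z)$, $\mathsf P_x^z$ is the law of the process under it starting from $x$, and $F(x,\cdot),G(x,\cdot)$ denote the metrics as functions of $z\in\mathbb R$. For an action $a$ and a policy $\pi$, $\langle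 a,\pi\rangle$ takes action $a$ at time $0$ and follows $\pi$ afterwards. $f(x,\pi)=F(x,\langle1,\pi\rangle)-F(x,\langle0,\pi\rangle)$, $g(x,\pi)=G(x,\langle1,\pi\rangle)-G(x,\langle0,\pi\rangle)$; $f(x,z),g(x,z)$ are these for the $z$-policy. The integral is a Lebesgue–Stieltjes integral with respect to $z\mapsto G(x,z)$ on $\mathbb R$ (mass $G(x,b)-G(x,a)$ on $(a,b]$). $m$ is extended to $\mathbb R$ by $m(z)=m(\ell)$ for $z<\ell$ and $m(z)=m(u)$ for $z>u$. A left-semiclosed interval is a set $\{z\in\mathbb R:a\le z<b\}$ with $-\infty\le a<b\le\infty$. The set of endpoints of a partition $\{S_i\}$ of $\mathbb R$ into left-semiclosed intervals or singletons is $\mathbb R\setminus\bigcup_i\mathring S_i$, with $\mathring S_i$ the interior of $S_i$. *)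

theory Defs
  imports "HOL-Probability.Probability"
begin

text \<open>
  Actions are Booleans: \<open>True\<close> is active (\<open>a = 1\<close>), \<open>False\<close> is passive (\<open>a = 0\<close>).
\<close>

record bandit_project =
  lo :: ereal
  hi :: ereal
  disc :: real
  reward :: "real \<Rightarrow> bool \<Rightarrow> real"
  consumption :: "real \<Rightarrow> bool \<Rightarrow> real"
  kern :: "bool \<Rightarrow> real \<Rightarrow> real measure"

definition states :: "bandit_project \<Rightarrow> real set" where
  "states P = {x. lo P \<le> ereal x \<and> ereal x \<le> hi P}"

definition state_space :: "bandit_project \<Rightarrow> real measure" where
  "state_space P = restrict_space borel (states P)"

text \<open>
  The drift condition is stated with the nonnegative integral, because the Bochner integral of a
  non-integrable weight would be \<open>0\<close> and make the condition vacuous.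
\<close>

definition wf_project :: "bandit_project \<Rightarrow> bool" where
  "wf_project P \<longleftrightarrow>
     lo P < hi P \<and> 0 \<le> disc P \<and> disc P < 1 \<and>
     (\<forall>a. kern P a \<in> state_space P \<rightarrow>\<^sub>M prob_algebra (state_space P)) \<and>
     (\<forall>a. continuous_on (states P) (\<lambda>x. reward P x a)) \<and>
     (\<forall>a. continuous_on (states P) (\<lambda>x. consumption P x a)) \<and>
     (\<forall>x\<in>states P. 0 \<le> consumption P x False \<and> consumption P x False < consumption P x True) \<and>
     (\<exists>(w :: real \<Rightarrow> real) (M :: real) (\<gamma> :: real).
        w \<in> borel_measurable (state_space P) \<and> (\<forall>x\<in>states P. 1 \<le> w x) \<and>
        0 < M \<and> disc P \<le> \<gamma> \<and> \<gamma> < 1 \<and>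
        (\<forall>x\<in>states P. \<forall>a.
           max \<bar>reward P x a\<bar> (consumption P x a) \<le> M * w x \<and>
           ennreal (disc P) * (\<integral>\<^sup>+ y. ennreal (w y) \<partial>kern P a x) \<le> ennreal (\<gamma> * w x)))"

text \<open>
  A policy is a randomized, history-dependent decision rule: \<open>\<pi> t h x\<close> is the distribution of
  \<open>A\<^sub>t\<close> given the past \<open>h = (X\<^sub>0, A\<^sub>0), \<dots>, (X\<^bsub>t-1\<^esub>, A\<^bsub>t-1\<^esub>)\<close> and the current state \<open>x = X\<^sub>t\<close>.
  A past \<open>h\<close> is an element of a product over \<open>{0..<t}\<close>, hence carries no information about later times.
\<close>

type_synonym history = "nat \<Rightarrow> real \<times> bool"
type_synonym policy = "nat \<Rightarrow> history \<Rightarrow> real \<Rightarrow> bool measure"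

definition step_space :: "bandit_project \<Rightarrow> (real \<times> bool) measure" where
  "step_space P = state_space P \<Otimes>\<^sub>M count_space UNIV"

definition nonanticipative :: "bandit_project \<Rightarrow> policy \<Rightarrow> bool" where
  "nonanticipative P \<pi> \<longleftrightarrow>
     (\<forall>t. (\<lambda>(h, x). \<pi> t h x) \<in>
        (PiM {0..<t} (\<lambda>_. step_space P) \<Otimes>\<^sub>M state_space P) \<rightarrow>\<^sub>M prob_algebra (count_space UNIV))"

definition next_state :: "bandit_project \<Rightarrow> real \<Rightarrow> nat \<Rightarrow> history \<Rightarrow> real measure" where
  "next_state P x t h =
     (if t = 0 then return (state_space P) x
      else kern P (snd (h (t - 1))) (fst (h (t - 1))))"

definition next_step :: "bandit_project \<Rightarrow> real \<Rightarrow> policy \<Rightarrow> nat \<Rightarrow> history \<Rightarrow> (real \<times> bool) measure" where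
  "next_step P x \<pi> t h =
     next_state P x t h \<bind> (\<lambda>y. \<pi> t h y \<bind> (\<lambda>a. return (step_space P) (y, a)))"

text \<open>
  The law of \<open>(X\<^sub>t, A\<^sub>t)\<^sub>t\<close> under policy \<open>\<pi>\<close> with \<open>X\<^sub>0 = x\<close>, given by the Ionescu-Tulcea extension.
\<close>

definition law :: "bandit_project \<Rightarrow> real \<Rightarrow> policy \<Rightarrow> (nat \<Rightarrow> real \<times> bool) measure" where
  "law P x \<pi> =
     projective_family.lim UNIV
       (Ionescu_Tulcea.CI (next_step P x \<pi>) (\<lambda>_. step_space P)) (\<lambda>_. step_space P)"

definition metric_F :: "bandit_project \<Rightarrow> real \<Rightarrow> policy \<Rightarrow> real" where
  "metric_F P x \<pi> = (\<integral>\<omega>. (\<Sum>t. disc P ^ t * reward P (fst (\<omega> t)) (snd (\<omega> t))) \<partial>law P x \<pi>)"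

definition metric_G :: "bandit_project \<Rightarrow> real \<Rightarrow> policy \<Rightarrow> real" where
  "metric_G P x \<pi> = (\<integral>\<omega>. (\<Sum>t. disc P ^ t * consumption P (fst (\<omega> t)) (snd (\<omega> t))) \<partial>law P x \<pi>)"

definition threshold :: "ereal \<Rightarrow> policy" where
  "threshold z = (\<lambda>t h x. return (count_space UNIV) (z < ereal x))"

text \<open>
  \<open>first_then a \<pi>\<close> takes action \<open>a\<close> at time \<open>0\<close> and then restarts \<open>\<pi>\<close> at time \<open>1\<close>, that is, \<open>\<pi>\<close>
  is shown the history from time \<open>1\<close> on.
\<close>

definition first_then :: "bool \<Rightarrow> policy \<Rightarrow> policy" where
  "first_then a \<pi> = (\<lambda>t h x.
     if t = 0 then return (count_space UNIV) a
     else \<pi> (t - 1) (\<lambda>i\<in>{0..<t - 1}. h (Suc i)) x)"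

text \<open>
  The kernels below meet the hypotheses of the Ionescu-Tulcea theorem, so \<^const>\<open>law\<close> is a genuine law.
\<close>

lemma space_state_space: "space (state_space P) = states P"
  by (simp add: state_space_def space_restrict_space)

lemma threshold_nonanticipative: "nonanticipative P (threshold z)"
proof -
  have id: "(\<lambda>x. x) \<in> state_space P \<rightarrow>\<^sub>M borel" unfolding state_space_def by (rule measurable_restrict_space1) simp
  have "(\<lambda>x. z < ereal x) \<in> state_space P \<rightarrow>\<^sub>M count_space UNIV"
    using id by measurable
  then show ?thesis
    unfolding nonanticipative_def threshold_def split_def
    by (intro allI measurable_prob_algebraI prob_space_return measurable_compose[OF _ return_measurable]) simp_all
qed

lemma first_then_nonanticipative:
  assumes "nonanticipative P \<pi>"
  shows "nonanticipative P (first_then a \<pi>)"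
  unfolding nonanticipative_def
proof
  fix t :: nat
  show "(\<lambda>(h, x). first_then a \<pi> t h x) \<in>
        (PiM {0..<t} (\<lambda>_. step_space P) \<Otimes>\<^sub>M state_space P) \<rightarrow>\<^sub>M prob_algebra (count_space UNIV)"
  proof (cases t)
    case 0
    then show ?thesis
      by (auto simp: first_then_def split_def space_prob_algebra intro!: prob_space_return measurable_const)
  next
    case (Suc n)
    have shift: "(\<lambda>p. (\<lambda>i\<in>{0..<n}. fst p (Suc i), snd p)) \<in>
      (PiM {0..<Suc n} (\<lambda>_. step_space P) \<Otimes>\<^sub>M state_space P) \<rightarrow>\<^sub>M
      (PiM {0..<n} (\<lambda>_. step_space P) \<Otimes>\<^sub>M state_space P)"
      by (intro measurable_Pair measurable_restrict measurable_snd
          measurable_compose[OF measurable_fst measurable_component_singleton]) auto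
    have "(\<lambda>(h, x). \<pi> n h x) \<in>
        (PiM {0..<n} (\<lambda>_. step_space P) \<Otimes>\<^sub>M state_space P) \<rightarrow>\<^sub>M prob_algebra (count_space UNIV)"
      using assms by (simp add: nonanticipative_def)
    from measurable_compose[OF shift this] show ?thesis
      by (simp add: Suc first_then_def split_def)
  qed
qed

lemma next_step_Ionescu_Tulcea:
  assumes P: "wf_project P" and \<pi>: "nonanticipative P \<pi>" and x: "x \<in> states P"
  shows "Ionescu_Tulcea (next_step P x \<pi>) (\<lambda>_. step_space P)"
proof -
  have kern: "kern P a \<in> state_space P \<rightarrow>\<^sub>M prob_algebra (state_space P)" for a
    using P by (simp add: wf_project_def)
  have ns: "next_state P x t \<in> PiM {0..<t} (\<lambda>_. step_space P) \<rightarrow>\<^sub>M prob_algebra (state_space P)" for t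
  proof (cases t)
    case 0
    then have "next_state P x t = (\<lambda>_. return (state_space P) x)"
      by (simp add: fun_eq_iff next_state_def)
    then show ?thesis using x
      by (auto simp: space_prob_algebra space_state_space intro!: prob_space_return)
  next
    case (Suc n)
    have K: "(\<lambda>p. kern P (snd p) (fst p)) \<in> step_space P \<rightarrow>\<^sub>M prob_algebra (state_space P)"
      unfolding step_space_def
      by (rule measurable_compose_countable'[where I=UNIV and g=snd and f="\<lambda>a p. kern P a (fst p)"])
         (auto intro: measurable_compose[OF measurable_fst kern])
    have "(\<lambda>h. h n) \<in> PiM {0..<t} (\<lambda>_. step_space P) \<rightarrow>\<^sub>M step_space P"
      by (rule measurable_component_singleton) (simp add: Suc)
    from measurable_compose[OF this K] show ?thesis
      by (simp add: next_state_def[abs_def] Suc)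
  qed
  have ret: "(\<lambda>q. return (step_space P) (snd (fst q), snd q)) \<in>
      (PiM {0..<t} (\<lambda>_. step_space P) \<Otimes>\<^sub>M state_space P) \<Otimes>\<^sub>M count_space UNIV
      \<rightarrow>\<^sub>M prob_algebra (step_space P)" for t :: nat
    by (intro measurable_compose[OF _ measurable_return_prob_space]) (auto simp: step_space_def)
  have "next_step P x \<pi> t \<in> PiM {0..<t} (\<lambda>_. step_space P) \<rightarrow>\<^sub>M prob_algebra (step_space P)" for t
  proof -
    have p: "(\<lambda>p. \<pi> t (fst p) (snd p)) \<in>
        (PiM {0..<t} (\<lambda>_. step_space P) \<Otimes>\<^sub>M state_space P) \<rightarrow>\<^sub>M prob_algebra (count_space UNIV)"
      using \<pi> by (simp add: nonanticipative_def split_def)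
    have "(\<lambda>p. \<pi> t (fst p) (snd p) \<bind> (\<lambda>a. return (step_space P) (snd p, a))) \<in>
        (PiM {0..<t} (\<lambda>_. step_space P) \<Otimes>\<^sub>M state_space P) \<rightarrow>\<^sub>M prob_algebra (step_space P)"
      by (rule measurable_bind_prob_space2[OF p]) (use ret in \<open>simp add: split_def\<close>)
    then show ?thesis
      unfolding next_step_def
      by (intro measurable_bind_prob_space2[OF ns]) (simp add: split_def)
  qed
  note step = this
  show ?thesis
  proof (rule Ionescu_Tulcea.intro)
    show "next_step P x \<pi> t \<in> PiM {0..<t} (\<lambda>_. step_space P) \<rightarrow>\<^sub>M subprob_algebra (step_space P)" for t
      by (rule measurable_prob_algebraD[OF step])
    show "prob_space (next_step P x \<pi> t h)" if "h \<in> space (PiM {0..<t} (\<lambda>_. step_space P))" for t h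
      using measurable_space[OF step that] by (simp add: space_prob_algebra)
  qed
qed

definition marginal_f :: "bandit_project \<Rightarrow> real \<Rightarrow> policy \<Rightarrow> real" where
  "marginal_f P x \<pi> = metric_F P x (first_then True \<pi>) - metric_F P x (first_then False \<pi>)"

definition marginal_g :: "bandit_project \<Rightarrow> real \<Rightarrow> policy \<Rightarrow> real" where
  "marginal_g P x \<pi> = metric_G P x (first_then True \<pi>) - metric_G P x (first_then False \<pi>)"

definition mp_index :: "bandit_project \<Rightarrow> real \<Rightarrow> real" where
  "mp_index P x = marginal_f P x (threshold (ereal x)) / marginal_g P x (threshold (ereal x))"

definition mp_index_ext :: "bandit_project \<Rightarrow> real \<Rightarrow> real" where
  "mp_index_ext P z =
     (if ereal z < lo P then mp_index P (real_of_ereal (lo P))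
      else if hi P < ereal z then mp_index P (real_of_ereal (hi P))
      else mp_index P z)"

definition PCLI1 :: "bandit_project \<Rightarrow> bool" where
  "PCLI1 P \<longleftrightarrow> (\<forall>x\<in>states P. \<forall>z. marginal_g P x (threshold z) > 0)"

definition PCLI2 :: "bandit_project \<Rightarrow> bool" where
  "PCLI2 P \<longleftrightarrow> mono_on (states P) (mp_index P) \<and> continuous_on (states P) (mp_index P)"

definition left_semiclosed :: "real set \<Rightarrow> bool" where
  "left_semiclosed S \<longleftrightarrow> (\<exists>a b :: ereal. a < b \<and> S = {z. a \<le> ereal z \<and> ereal z < b})"

definition lsc_partition :: "real set set \<Rightarrow> bool" where
  "lsc_partition \<S> \<longleftrightarrow>
     partition_on UNIV \<S> \<and> (\<forall>S\<in>\<S>. left_semiclosed S \<or> (\<exists>z. S = {z}))"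

definition endpoints :: "real set set \<Rightarrow> real set" where
  "endpoints \<S> = UNIV - (\<Union>S\<in>\<S>. interior S)"

definition cond_A :: "bandit_project \<Rightarrow> bool" where
  "cond_A P \<longleftrightarrow>
     (\<forall>x\<in>states P. \<exists>\<S> (v :: real set \<Rightarrow> real).
        countable \<S> \<and> lsc_partition \<S> \<and>
        (\<forall>z. ((\<lambda>S. v S * indicator S z) has_sum metric_G P x (threshold (ereal z))) \<S>))"

definition cond_B :: "bandit_project \<Rightarrow> bool" where
  "cond_B P \<longleftrightarrow>
     (\<forall>x\<in>states P. \<exists>D. countable D \<and> (\<exists>\<S>. lsc_partition \<S> \<and> D = endpoints \<S>) \<and>
        (\<forall>z. \<P>(\<omega> in law P x (threshold z). \<forall>t. fst (\<omega> t) \<in> D) = 1))"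

text \<open>
  Lebesgue-Stieltjes integral over a set with respect to an integrator \<open>H\<close> of locally bounded
  variation, through a decomposition of \<open>H\<close> into nondecreasing right-continuous functions. The
  value does not depend on the decomposition. The functions \<open>metric_G P x\<close> of interest are nonincreasing
  in the threshold, so their measures are negative and \<^const>\<open>interval_measure\<close> does not apply directly.
\<close>

definition has_LS_integral ::
    "(real \<Rightarrow> real) \<Rightarrow> (real \<Rightarrow> real) \<Rightarrow> real set \<Rightarrow> real \<Rightarrow> bool" where
  "has_LS_integral \<phi> H A I \<longleftrightarrow>
     (\<exists>H1 H2.
        mono H1 \<and> (\<forall>z. continuous (at_right z) H1) \<and>
        mono H2 \<and> (\<forall>z. continuous (at_right z) H2) \<and>
        (\<forall>z. H z = H1 z - H2 z) \<and>
        set_integrable (interval_measure H1) A \<phi> \<and>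
        set_integrable (interval_measure H2) A \<phi> \<and>
        I = (LINT z:A|interval_measure H1. \<phi> z) - (LINT z:A|interval_measure H2. \<phi> z))"

end

theory Submission
  imports Defs
begin

text \<open>
  If \<open>V\<close> is the value of a stationary rule \<open>b'\<close>, the value of another rule \<open>b\<close> exceeds it by the
  discounted expectation, under \<open>b\<close>, of the one-step advantages over \<open>b'\<close> in the states where the rules
  disagree. For thresholds \<open>z\<^sub>1 < z\<^sub>2\<close> these are the states in \<open>(z\<^sub>1, z\<^sub>2]\<close>. With PCLI1 it follows that
  \<open>G(x, \<cdot>)\<close> is nonincreasing and that \<open>F(x, \<cdot>)\<close> is constant wherever \<open>G(x, \<cdot>)\<close> is. By dominated
  convergence both are right-continuous and have left limits, namely the values of the rule that is active on
  \<open>{z..}\<close>, so at \<open>z\<close> they jump in the ratio \<open>f(z, z) / g(z, z) = m(z)\<close>. Hence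
  \<open>F(x, z) - \<integral>\<^bsub>(a, z]\<^esub> m dG\<close> is continuous in \<open>z\<close> and is determined by the value of \<open>G(x, z)\<close>. Each of the
  two structural conditions makes the range of \<open>G(x, \<cdot>)\<close> countable; a continuous function with countable
  range on an interval is constant.
\<close>

subsection \<open>Stieltjes integrals against integrators with countable range\<close>

text \<open>On \<open>{a<..b}\<close> the monotone integrand lies between its end values, and this
  interval has mass \<open>G b - G a\<close>. Comparison with the two constants gives both bounds;
  boundedness on a set of finite mass gives integrability.\<close>

lemma interval_measure_integral_bounds:
  fixes \<phi> G :: "real \<Rightarrow> real"
  assumes G: "mono G" "\<And>z. continuous (at_right z) G" and \<phi>: "mono \<phi>" and ab: "a \<le> b"
  shows "set_integrable (interval_measure G) {a<..b} \<phi>"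
    and "\<phi> a * (G b - G a) \<le> (LINT z:{a<..b}|interval_measure G. \<phi> z)"
    and "(LINT z:{a<..b}|interval_measure G. \<phi> z) \<le> \<phi> b * (G b - G a)"
proof -
  let ?M = "interval_measure G"
  have [measurable]: "\<phi> \<in> borel_measurable borel" by (rule borel_measurable_mono[OF \<phi>])
  have em: "emeasure ?M {a<..b} = ennreal (G b - G a)"
    using monoD[OF G(1)] G(2) ab by (intro emeasure_interval_measure_Ioc) auto
  have m: "measure ?M {a<..b} = G b - G a"
    using monoD[OF G(1)] G(2) ab by (intro measure_interval_measure_Ioc) auto
  have const: "set_integrable ?M {a<..b} (\<lambda>_. c)" for c :: real
    using em by (auto simp: set_integrable_def)
  have ci: "(LINT z:{a<..b}|?M. c) = c * (G b - G a)" for c :: real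
    using em m by (simp add: set_lebesgue_integral_def)
  show int: "set_integrable ?M {a<..b} \<phi>"
    unfolding set_integrable_def
  proof (rule Bochner_Integration.integrable_bound)
    show "integrable ?M (\<lambda>x. indicat_real {a<..b} x *\<^sub>R (\<bar>\<phi> a\<bar> + \<bar>\<phi> b\<bar>))"
      using const unfolding set_integrable_def .
    show "AE x in ?M. norm (indicat_real {a<..b} x *\<^sub>R \<phi> x) \<le> norm (indicat_real {a<..b} x *\<^sub>R (\<bar>\<phi> a\<bar> + \<bar>\<phi> b\<bar>))"
    proof (rule AE_I2)
      fix x
      show "norm (indicat_real {a<..b} x *\<^sub>R \<phi> x) \<le> norm (indicat_real {a<..b} x *\<^sub>R (\<bar>\<phi> a\<bar> + \<bar>\<phi> b\<bar>))"
        using monoD[OF \<phi>, of a x] monoD[OF \<phi>, of x b] by (auto simp: indicator_def)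
    qed
  qed simp
  show "\<phi> a * (G b - G a) \<le> (LINT z:{a<..b}|?M. \<phi> z)"
    unfolding ci[symmetric] by (rule set_integral_mono[OF const int]) (auto intro: monoD[OF \<phi>])
  show "(LINT z:{a<..b}|?M. \<phi> z) \<le> \<phi> b * (G b - G a)"
    unfolding ci[symmetric] by (rule set_integral_mono[OF int const]) (auto intro: monoD[OF \<phi>])
qed

text \<open>The integrator is nondecreasing here and will be minus the consumption value, which
  accounts for the sign. In \<open>cont\<close> the coefficient is frozen at
  \<open>\<phi> z\<close>: a jump of \<open>F\<close> at \<open>z\<close> is
  \<open>- \<phi> z\<close> times the jump of \<open>G\<close>, which is what the integral cancels
  in \<open>J\<close>.\<close>

lemma interval_measure_integral_countable_range:
  fixes \<phi> F G :: "real \<Rightarrow> real"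
  assumes G: "mono G" "\<And>z. continuous (at_right z) G" and \<phi>: "mono \<phi>" "\<And>z. isCont \<phi> z"
    and cont: "\<And>z. isCont (\<lambda>y. F y + \<phi> z * G y) z"
    and FG: "\<And>y z. G y = G z \<Longrightarrow> F y = F z"
    and count: "countable (range G)" and ab: "a \<le> b"
  shows "F b - F a = - (LINT z:{a<..b}|interval_measure G. \<phi> z)"
proof -
  define I where "I y z = (LINT t:{y<..z}|interval_measure G. \<phi> t)" for y z
  define J where "J z = F z + I a z" for z
  note rem = interval_measure_integral_bounds[OF G \<phi>(1), folded I_def]
  have I_add: "I a z = I a y + I y z" if "a \<le> y" "y \<le> z" for y z
  proof -
    have "{a<..z} = {a<..y} \<union> {y<..z}" using that by auto
    then show ?thesis
      unfolding I_def using that rem(1)[of a y] rem(1)[of y z]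
      by (simp add: set_integral_Un)
  qed
  \<comment> \<open>\<open>I y z\<close> lies between \<open>\<phi> y\<close> and
    \<open>\<phi> z\<close> times the increment of \<open>G\<close>. Replacing it by
    \<open>\<phi> c\<close> times that increment, at either end \<open>c\<close>, costs at most the
    product of the two increments.\<close>
  have J_diff: "\<bar>(J z - J y) - ((F z + \<phi> c * G z) - (F y + \<phi> c * G y))\<bar> \<le> \<bar>\<phi> z - \<phi> y\<bar> * \<bar>G z - G y\<bar>"
    if "a \<le> y" "y \<le> z" "c = y \<or> c = z" for y z c
  proof -
    have *: "(J z - J y) - ((F z + \<phi> c * G z) - (F y + \<phi> c * G y)) = I y z - \<phi> c * (G z - G y)"
      using I_add[OF that(1,2)] by (simp add: J_def algebra_simps)
    have "G y \<le> G z" "\<phi> y \<le> \<phi> z" using monoD[OF G(1)] monoD[OF \<phi>(1)] that by auto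
    then show ?thesis
      unfolding * abs_of_nonneg[of "\<phi> z - \<phi> y"] abs_of_nonneg[of "G z - G y"]
      using rem(2,3)[OF that(2)] that(3) by (auto simp: abs_le_iff algebra_simps)
  qed
  \<comment> \<open>As \<open>y\<close> tends to \<open>z\<close> from either side the coefficient
    has to stay \<open>\<phi> z\<close>, hence the choice of \<open>c\<close> above. The increment
    of \<open>G\<close> is bounded uniformly in \<open>y\<close>, so the factor
    \<open>\<phi> y - \<phi> z\<close> makes the error vanish.\<close>
  have J_diff': "\<bar>(J y - J z) - ((F y + \<phi> z * G y) - (F z + \<phi> z * G z))\<bar>
      \<le> \<bar>\<phi> y - \<phi> z\<bar> * (\<bar>G a\<bar> + \<bar>G b\<bar>) * 2" if "y \<in> {a..b}" "z \<in> {a..b}" for y z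
  proof -
    have "\<bar>(J y - J z) - ((F y + \<phi> z * G y) - (F z + \<phi> z * G z))\<bar> \<le> \<bar>\<phi> y - \<phi> z\<bar> * \<bar>G y - G z\<bar>"
    proof (cases "y \<le> z")
      case True
      have flip: "\<bar>(J y - J z) - ((F y + \<phi> z * G y) - (F z + \<phi> z * G z))\<bar>
          = \<bar>(J z - J y) - ((F z + \<phi> z * G z) - (F y + \<phi> z * G y))\<bar>"
        by (subst abs_minus_commute, rule arg_cong[where f=abs]) simp
      show ?thesis
        unfolding flip abs_minus_commute[of "\<phi> y"] abs_minus_commute[of "G y"]
        using J_diff[of y z z] that True by simp
    next
      case False
      then show ?thesis using J_diff[of z y z] that by simp
    qed
    also have "\<bar>G y - G z\<bar> \<le> (\<bar>G a\<bar> + \<bar>G b\<bar>) * 2"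
      using monoD[OF G(1), of a y] monoD[OF G(1), of a z] monoD[OF G(1), of y b] monoD[OF G(1), of z b] that
      by auto
    finally show ?thesis by (simp add: mult_left_mono mult.assoc)
  qed
  have "continuous_on {a..b} J"
    unfolding continuous_on_def
  proof
    fix z assume z: "z \<in> {a..b}"
    let ?F = "at z within {a..b}"
    have c1: "((\<lambda>y. F y + \<phi> z * G y) \<longlongrightarrow> F z + \<phi> z * G z) ?F"
      using cont[of z] unfolding isCont_def by (rule tendsto_within_subset) simp
    have c2: "(\<phi> \<longlongrightarrow> \<phi> z) ?F"
      using \<phi>(2)[of z] unfolding isCont_def by (rule tendsto_within_subset) simp
    have "((\<lambda>y. \<bar>\<phi> y - \<phi> z\<bar> * (\<bar>G a\<bar> + \<bar>G b\<bar>) * 2) \<longlongrightarrow> \<bar>\<phi> z - \<phi> z\<bar> * (\<bar>G a\<bar> + \<bar>G b\<bar>) * 2) ?F"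
      by (intro tendsto_intros c2)
    then have "((\<lambda>y. \<bar>\<phi> y - \<phi> z\<bar> * (\<bar>G a\<bar> + \<bar>G b\<bar>) * 2) \<longlongrightarrow> 0) ?F" by simp
    then have "((\<lambda>y. (J y - J z) - ((F y + \<phi> z * G y) - (F z + \<phi> z * G z))) \<longlongrightarrow> 0) ?F"
      by (rule Lim_null_comparison[rotated])
        (use J_diff' z in \<open>auto simp: eventually_at_topological intro!: exI[of _ UNIV]\<close>)
    from tendsto_add[OF this tendsto_diff[OF c1 tendsto_const[of "F z + \<phi> z * G z"]]]
    have "((\<lambda>y. J y - J z) \<longlongrightarrow> 0) ?F" by simp
    then show "(J \<longlongrightarrow> J z) ?F" by (simp add: LIM_zero_iff)
  qed
  then have "connected (J ` {a..b})"
    by (rule connected_continuous_image) simp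
  moreover have "countable (J ` {a..b})"
  proof -
    \<comment> \<open>With equal values of \<open>G\<close> the error bound is zero and
      \<open>FG\<close> removes the increment of \<open>F\<close>. So \<open>J\<close> factors
      through \<open>G\<close> on \<open>{a..b}\<close> and inherits a countable range.\<close>
    have J_eq: "J y = J z" if "y \<in> {a..b}" "z \<in> {a..b}" "y \<le> z" "G y = G z" for y z
      using J_diff[of y z y] that FG[of y z] by auto
    then have J_eq: "J y = J z" if "y \<in> {a..b}" "z \<in> {a..b}" "G y = G z" for y z
      using that by (metis linear)
    have "J z = J (SOME y. y \<in> {a..b} \<and> G y = G z)" if "z \<in> {a..b}" for z
    proof -
      let ?y = "SOME y. y \<in> {a..b} \<and> G y = G z"
      have "?y \<in> {a..b} \<and> G ?y = G z" by (rule someI[of _ z]) (use that in simp)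
      then show ?thesis using J_eq[of z ?y] that by simp
    qed
    then have "J ` {a..b} \<subseteq> (\<lambda>g. J (SOME y. y \<in> {a..b} \<and> G y = g)) ` range G"
      by auto
    then show ?thesis
      by (rule countable_subset) (intro countable_image count)
  qed
  \<comment> \<open>A connected set of reals with two distinct points is uncountable.\<close>
  ultimately have "J a = J b"
    using connected_uncountable[of "J ` {a..b}" "J a" "J b"] ab by auto
  moreover have "I a a = 0" by (simp add: I_def set_lebesgue_integral_def)
  ultimately show ?thesis by (simp add: J_def I_def)
qed

subsection \<open>Laws of coordinates and integrals over kernel compositions\<close>

context Ionescu_Tulcea
begin

text \<open>The least bound \<open>up_to\<close> of an initial segment is its length, so the
  projection from \<open>C 0 n\<close> is trivial.\<close>

lemma CI_initial_segment: "CI {0..<n} = C 0 n (\<lambda>_. undefined)"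
proof -
  have "up_to {0..<n} \<le> k \<longleftrightarrow> n \<le> k" for k
    by (subst up_to_iff_Ico) auto
  from this[of n] this[of "up_to {0..<n}"] have "up_to {0..<n} = n" by auto
  then show ?thesis
    using distr_C[of n n "\<lambda>_. undefined" 0] by (simp add: CI_def)
qed

lemma distr_eP_component:
  assumes \<omega>: "\<omega> \<in> space (PiM {0..<n} M)"
  shows "distr (eP n \<omega>) (M n) (\<lambda>h. h n) = P n \<omega>"
proof -
  have upd: "fun_upd \<omega> n \<in> P n \<omega> \<rightarrow>\<^sub>M PiM {0..<Suc n} M"
    using \<omega> by (auto intro!: measurable_fun_upd[where J="{0..<n}"] simp: measurable_cong_sets[OF sets_P refl])
  have "distr (eP n \<omega>) (M n) (\<lambda>h. h n) = distr (P n \<omega>) (M n) ((\<lambda>h. h n) \<circ> fun_upd \<omega> n)"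
    unfolding eP_def by (rule distr_distr[OF _ upd]) (auto intro!: measurable_component_singleton)
  also have "\<dots> = P n \<omega>"
    by (simp add: comp_def distr_id2 sets_P[OF \<omega>])
  finally show ?thesis .
qed

text \<open>Coordinate \<open>n\<close> can be read off the first \<open>n + 1\<close> coordinates,
  and their law arises by drawing the first \<open>n\<close> and appending one draw from
  \<open>P n\<close>. This gives a recursion for the one-dimensional marginals.\<close>

lemma distr_lim_component:
  "distr PF.lim (M n) (\<lambda>\<omega>. \<omega> n) =
     distr PF.lim (PiM {0..<n} M) (\<lambda>\<omega>. restrict \<omega> {0..<n}) \<bind> P n"
proof -
  let ?C = "\<lambda>n. C 0 n (\<lambda>_. undefined)"
  have sp: "space (?C n) = space (PiM {0..<n} M)" by (simp add: space_C)
  have eP: "eP n \<in> ?C n \<rightarrow>\<^sub>M subprob_algebra (PiM {0..<Suc n} M)"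
    using measurable_eP[of n] by (simp add: measurable_cong_sets[OF sets_C refl])
  have ne: "space (?C n) \<noteq> {}"
    by (rule prob_space.not_empty, rule prob_space_C) simp
  have "distr PF.lim (M n) (\<lambda>\<omega>. \<omega> n)
      = distr (distr PF.lim (PiM {0..<Suc n} M) (\<lambda>\<omega>. restrict \<omega> {0..<Suc n})) (M n) (\<lambda>h. h n)"
    by (subst distr_distr)
       (auto simp: comp_def measurable_cong_sets[OF PF.sets_lim refl]
             intro!: measurable_restrict measurable_component_singleton)
  also have "\<dots> = distr (?C n \<bind> eP n) (M n) (\<lambda>h. h n)"
    by (simp add: distr_lim CI_initial_segment)
  also have "\<dots> = ?C n \<bind> (\<lambda>\<omega>. distr (eP n \<omega>) (M n) (\<lambda>h. h n))"
    by (rule distr_bind[OF eP ne]) (auto intro!: measurable_component_singleton)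
  also have "\<dots> = ?C n \<bind> P n"
    by (rule bind_cong[OF refl]) (simp add: sp distr_eP_component)
  finally show ?thesis
    by (simp add: distr_lim CI_initial_segment)
qed

end

text \<open>Finiteness of the total integral forces the inner nonnegative integrals to be finite
  almost everywhere, and there they agree with the Bochner integrals.\<close>

lemma integral_bind_nonneg:
  fixes f :: "'b \<Rightarrow> real"
  assumes N: "N \<in> M \<rightarrow>\<^sub>M subprob_algebra B" and f: "f \<in> borel_measurable B"
    and nn: "\<And>y. 0 \<le> f y" and fin: "(\<integral>\<^sup>+x. f x \<partial>(M \<bind> N)) < \<infinity>" and ne: "space M \<noteq> {}"
  shows "integrable M (\<lambda>x. \<integral>y. f y \<partial>N x)" "(\<integral>y. f y \<partial>(M \<bind> N)) = (\<integral>x. (\<integral>y. f y \<partial>N x) \<partial>M)"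
proof -
  have sb: "sets (M \<bind> N) = sets B"
    using subprob_measurableD(2)[OF N] ne by (intro sets_bind) auto
  have fB: "f \<in> borel_measurable (M \<bind> N)"
    using f by (simp add: measurable_cong_sets[OF sb refl])
  have fN: "f \<in> borel_measurable (N x)" if "x \<in> space M" for x
    using f by (simp add: measurable_cong_sets[OF subprob_measurableD(2)[OF N that] refl])
  have nnb: "(\<integral>\<^sup>+x. f x \<partial>(M \<bind> N)) = (\<integral>\<^sup>+x. \<integral>\<^sup>+y. f y \<partial>N x \<partial>M)"
    using f by (intro nn_integral_bind[OF _ N]) simp
  have mI: "(\<lambda>x. \<integral>\<^sup>+y. f y \<partial>N x) \<in> borel_measurable M"
    by (rule measurable_compose[OF N nn_integral_measurable_subprob_algebra]) (use f in simp)
  have mL: "(\<lambda>x. \<integral>y. f y \<partial>N x) \<in> borel_measurable M"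
    by (rule measurable_compose[OF N integral_measurable_subprob_algebra[OF f]])
  have inner: "(\<integral>y. f y \<partial>N x) = enn2real (\<integral>\<^sup>+y. f y \<partial>N x)" if "x \<in> space M" for x
    by (rule integral_eq_nn_integral) (use fN[OF that] nn in auto)
  have "AE x in M. (\<integral>\<^sup>+y. f y \<partial>N x) \<noteq> \<infinity>"
    using nnb fin by (intro nn_integral_PInf_AE mI) auto
  then have AE: "AE x in M. ennreal (\<integral>y. f y \<partial>N x) = (\<integral>\<^sup>+y. f y \<partial>N x)"
    using AE_space by eventually_elim (simp add: inner less_top)
  have eq: "(\<integral>\<^sup>+x. ennreal (\<integral>y. f y \<partial>N x) \<partial>M) = (\<integral>\<^sup>+x. f x \<partial>(M \<bind> N))"
    unfolding nnb by (rule nn_integral_cong_AE[OF AE])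
  show "integrable M (\<lambda>x. \<integral>y. f y \<partial>N x)"
    by (rule integrableI_nonneg[OF mL AE_I2[OF Bochner_Integration.integral_nonneg]]) (use eq fin nn in auto)
  have "(\<integral>x. (\<integral>y. f y \<partial>N x) \<partial>M) = enn2real (\<integral>\<^sup>+x. ennreal (\<integral>y. f y \<partial>N x) \<partial>M)"
    by (rule integral_eq_nn_integral[OF mL AE_I2[OF Bochner_Integration.integral_nonneg]]) (rule nn)
  also have "\<dots> = (\<integral>y. f y \<partial>(M \<bind> N))"
    unfolding eq by (rule integral_eq_nn_integral[symmetric, OF fB]) (auto intro: nn)
  finally show "(\<integral>y. f y \<partial>(M \<bind> N)) = (\<integral>x. (\<integral>y. f y \<partial>N x) \<partial>M)" ..
qed

text \<open>Positive and negative parts reduce this to the nonnegative case. Integrability under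
  \<open>N x\<close> for every \<open>x\<close> lets the inner integral be split pointwise, without
  an exceptional set.\<close>

lemma integral_bind_integrable:
  fixes f :: "'b \<Rightarrow> real"
  assumes N: "N \<in> M \<rightarrow>\<^sub>M subprob_algebra B" and ne: "space M \<noteq> {}"
    and f: "integrable (M \<bind> N) f" and fN: "\<And>x. x \<in> space M \<Longrightarrow> integrable (N x) f"
  shows "integrable M (\<lambda>x. \<integral>y. f y \<partial>N x)" "(\<integral>y. f y \<partial>(M \<bind> N)) = (\<integral>x. (\<integral>y. f y \<partial>N x) \<partial>M)"
proof -
  have sb: "sets (M \<bind> N) = sets B"
    using subprob_measurableD(2)[OF N] ne by (intro sets_bind) auto
  have fB: "f \<in> borel_measurable B"
    using borel_measurable_integrable[OF f] by (simp add: measurable_cong_sets[OF sb refl])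
  let ?p = "\<lambda>y. max 0 (f y)" and ?n = "\<lambda>y. max 0 (- f y)"
  have ip: "integrable (M \<bind> N) ?p" and im: "integrable (M \<bind> N) ?n"
    using f by auto
  have fp: "(\<integral>\<^sup>+x. ?p x \<partial>(M \<bind> N)) < \<infinity>" and fm: "(\<integral>\<^sup>+x. ?n x \<partial>(M \<bind> N)) < \<infinity>"
    using ip im by (auto simp: integrable_iff_bounded)
  note p = integral_bind_nonneg[OF N _ _ fp ne] and n = integral_bind_nonneg[OF N _ _ fm ne]
  have split: "f y = ?p y - ?n y" for y by (simp add: max_def)
  have inner: "(\<integral>y. f y \<partial>N x) = (\<integral>y. ?p y \<partial>N x) - (\<integral>y. ?n y \<partial>N x)" if "x \<in> space M" for x
    by (subst split, rule Bochner_Integration.integral_diff) (use fN[OF that] in auto)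
  have "integrable M (\<lambda>x. (\<integral>y. ?p y \<partial>N x) - (\<integral>y. ?n y \<partial>N x))"
    using p n fB by auto
  then show "integrable M (\<lambda>x. \<integral>y. f y \<partial>N x)"
    by (subst Bochner_Integration.integrable_cong[OF refl inner])
  have "(\<integral>y. f y \<partial>(M \<bind> N)) = (\<integral>y. ?p y \<partial>(M \<bind> N)) - (\<integral>y. ?n y \<partial>(M \<bind> N))"
    by (subst split, rule Bochner_Integration.integral_diff[OF ip im])
  also have "\<dots> = (\<integral>x. (\<integral>y. ?p y \<partial>N x) - (\<integral>y. ?n y \<partial>N x) \<partial>M)"
    using p n fB by (subst Bochner_Integration.integral_diff) auto
  also have "\<dots> = (\<integral>x. (\<integral>y. f y \<partial>N x) \<partial>M)"
    by (rule Bochner_Integration.integral_cong[OF refl]) (simp add: inner)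
  finally show "(\<integral>y. f y \<partial>(M \<bind> N)) = (\<integral>x. (\<integral>y. f y \<partial>N x) \<partial>M)" .
qed

subsection \<open>State laws and values of Markov policies\<close>

lemma states_borel: "states P \<in> sets borel"
proof -
  have "states P = ereal -` {lo P..hi P}" by (auto simp: states_def)
  then show ?thesis
    using measurable_sets[of ereal borel borel "{lo P..hi P}"] by simp
qed

lemma sets_state_space_iff: "A \<in> sets (state_space P) \<longleftrightarrow> A \<in> sets borel \<and> A \<subseteq> states P"
  unfolding state_space_def using states_borel by (subst sets_restrict_space_iff) auto

lemma measurable_ident_state_space: "(\<lambda>x. x) \<in> borel_measurable (state_space P)"
  unfolding state_space_def by (rule measurable_restrict_space1) simp

text \<open>The rule may depend on time. This keeps the class closed under
  \<open>first_then\<close>, which prepends a constant rule and shifts the others.\<close>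

definition markov :: "(nat \<Rightarrow> real \<Rightarrow> bool) \<Rightarrow> policy" where
  "markov d = (\<lambda>t h x. return (count_space UNIV) (d t x))"

lemma threshold_eq_markov: "threshold z = markov (\<lambda>_ x. z < ereal x)"
  by (simp add: threshold_def markov_def)

lemma first_then_markov: "first_then a (markov d) = markov (case_nat (\<lambda>_. a) d)"
  by (auto simp: first_then_def markov_def fun_eq_iff split: nat.split)

lemma markov_nonanticipative:
  assumes "\<And>t. Measurable.pred (state_space P) (d t)"
  shows "nonanticipative P (markov d)"
proof -
  have "(\<lambda>(h, x). markov d t h x) \<in>
      (PiM {0..<t} (\<lambda>_. step_space P) \<Otimes>\<^sub>M state_space P) \<rightarrow>\<^sub>M prob_algebra (count_space UNIV)" for t
    unfolding markov_def split_def
    by (rule measurable_compose[OF measurable_compose[OF measurable_snd assms]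
          measurable_return_prob_space])
  then show ?thesis by (simp add: nonanticipative_def)
qed

text \<open>The marginal law of the state at time \<open>t\<close>, built by composing kernels
  without the path space. \<open>law_component\<close> identifies it with the marginal of
  \<open>law\<close>.\<close>

primrec state_law :: "bandit_project \<Rightarrow> (nat \<Rightarrow> real \<Rightarrow> bool) \<Rightarrow> real \<Rightarrow> nat \<Rightarrow> real measure" where
  "state_law P d x 0 = return (state_space P) x"
| "state_law P d x (Suc t) = state_law P d x t \<bind> (\<lambda>y. kern P (d t y) y)"

text \<open>The expected discounted total of \<open>q\<close>, with the sum outside the expectation.
  Keeping \<open>q\<close> arbitrary covers reward, consumption and their linear combinations at
  once.\<close>

definition val :: "bandit_project \<Rightarrow> (real \<Rightarrow> bool \<Rightarrow> real) \<Rightarrow> (nat \<Rightarrow> real \<Rightarrow> bool) \<Rightarrow> real \<Rightarrow> real" where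
  "val P q d x = (\<Sum>t. disc P ^ t * (\<integral>y. q y (d t y) \<partial>state_law P d x t))"

definition advantage :: "bandit_project \<Rightarrow> (real \<Rightarrow> bool \<Rightarrow> real) \<Rightarrow> (real \<Rightarrow> bool) \<Rightarrow> real \<Rightarrow> real" where
  "advantage P q b x =
     val P q (case_nat (\<lambda>_. True) (\<lambda>_. b)) x - val P q (case_nat (\<lambda>_. False) (\<lambda>_. b)) x"

section \<open>Growth estimates in the weighted supremum norm\<close>

locale weighted_project =
  fixes P :: bandit_project and w :: "real \<Rightarrow> real" and M \<gamma> :: real
  assumes wf: "wf_project P"
    and w_measurable: "w \<in> borel_measurable (state_space P)"
    and w_ge_1: "\<And>x. x \<in> states P \<Longrightarrow> 1 \<le> w x"
    and M_pos: "0 < M" and disc_le: "disc P \<le> \<gamma>" and \<gamma>_less_1: "\<gamma> < 1"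
    and cost_le: "\<And>x a. x \<in> states P \<Longrightarrow> max \<bar>reward P x a\<bar> (consumption P x a) \<le> M * w x"
    and drift: "\<And>x a. x \<in> states P \<Longrightarrow>
      ennreal (disc P) * (\<integral>\<^sup>+y. ennreal (w y) \<partial>kern P a x) \<le> ennreal (\<gamma> * w x)"
begin

abbreviation "\<beta> \<equiv> disc P"
abbreviation "S \<equiv> state_space P"
abbreviation "X \<equiv> states P"

lemma \<beta>_nonneg: "0 \<le> \<beta>" and \<gamma>_nonneg: "0 \<le> \<gamma>"
  using wf disc_le by (auto simp: wf_project_def)

lemma w_nonneg: "x \<in> X \<Longrightarrow> 0 \<le> w x"
  using w_ge_1[of x] by linarith

text \<open>Measurable functions in the ball of radius \<open>C\<close> of the weighted supremum
  norm with weight \<open>w\<close>.\<close>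

definition dominated :: "real \<Rightarrow> (real \<Rightarrow> real) \<Rightarrow> bool" where
  "dominated C h \<longleftrightarrow> 0 \<le> C \<and> h \<in> borel_measurable S \<and> (\<forall>x\<in>X. \<bar>h x\<bar> \<le> C * w x)"

definition cost :: "real \<Rightarrow> (real \<Rightarrow> bool \<Rightarrow> real) \<Rightarrow> bool" where
  "cost C q \<longleftrightarrow> (\<forall>a. dominated C (\<lambda>x. q x a))"

abbreviation rule_measurable :: "(nat \<Rightarrow> real \<Rightarrow> bool) \<Rightarrow> bool" where
  "rule_measurable d \<equiv> (\<forall>t. Measurable.pred S (d t))"

lemma kern_measurable: "kern P a \<in> S \<rightarrow>\<^sub>M prob_algebra S"
  using wf by (simp add: wf_project_def)

lemma step_measurable:
  assumes "Measurable.pred S b"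
  shows "(\<lambda>y. kern P (b y) y) \<in> S \<rightarrow>\<^sub>M prob_algebra S"
  by (rule measurable_compose_countable'[where I=UNIV and g=b and f="\<lambda>a. kern P a"])
     (use assms kern_measurable in auto)

lemma state_law_measurable:
  assumes "rule_measurable d"
  shows "(\<lambda>x. state_law P d x t) \<in> S \<rightarrow>\<^sub>M prob_algebra S"
proof (induction t)
  case 0
  then show ?case by simp
next
  case (Suc t)
  from measurable_bind_prob_space[OF this step_measurable] assms show ?case by simp
qed

lemma state_law:
  assumes "rule_measurable d" "x \<in> X"
  shows "prob_space (state_law P d x t)" "sets (state_law P d x t) = sets S"
    "space (state_law P d x t) = X"
proof -
  have "state_law P d x t \<in> space (prob_algebra S)"
    using measurable_space[OF state_law_measurable[OF assms(1)]] assms(2)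
    by (simp add: space_state_space)
  then show "prob_space (state_law P d x t)" "sets (state_law P d x t) = sets S"
    by (auto simp: space_prob_algebra)
  then show "space (state_law P d x t) = X"
    using sets_eq_imp_space_eq[of "state_law P d x t" S] by (simp add: space_state_space)
qed

lemma kern:
  assumes "x \<in> X"
  shows "prob_space (kern P a x)" "sets (kern P a x) = sets S" "space (kern P a x) = X"
proof -
  have "kern P a x \<in> space (prob_algebra S)"
    using measurable_space[OF kern_measurable] assms by (simp add: space_state_space)
  then show "prob_space (kern P a x)" "sets (kern P a x) = sets S"
    by (auto simp: space_prob_algebra)
  then show "space (kern P a x) = X"
    using sets_eq_imp_space_eq[of "kern P a x" S] by (simp add: space_state_space)
qed

lemma state_law_Suc_measurable:
  assumes "rule_measurable d" "x \<in> X"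
  shows "(\<lambda>y. kern P (d t y) y) \<in> state_law P d x t \<rightarrow>\<^sub>M subprob_algebra S"
  using measurable_prob_algebraD[OF step_measurable] assms(1)
  by (simp add: measurable_cong_sets[OF state_law(2)[OF assms] refl])

text \<open>\<open>state_law\<close> appends steps at the end; associativity of the kernel
  composition peels off the first step instead, as the Bellman equation requires.\<close>

lemma state_law_Suc_left:
  assumes d: "rule_measurable d" and x: "x \<in> X"
  shows "state_law P d x (Suc t) = kern P (d 0 x) x \<bind> (\<lambda>y. state_law P (\<lambda>t. d (Suc t)) y t)"
proof (induction t)
  case 0
  have "state_law P d x (Suc 0) = kern P (d 0 x) x"
    using measurable_prob_algebraD[OF step_measurable] d x
    by (simp add: bind_return[where N=S] space_state_space)
  also have "\<dots> = kern P (d 0 x) x \<bind> return S"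
    by (rule bind_return''[symmetric]) (rule kern(2)[OF x])
  finally show ?case by simp
next
  case (Suc t)
  have m1: "(\<lambda>y. state_law P (\<lambda>t. d (Suc t)) y t) \<in> kern P (d 0 x) x \<rightarrow>\<^sub>M subprob_algebra S"
    using measurable_prob_algebraD[OF state_law_measurable[of "\<lambda>t. d (Suc t)"]] d
    by (simp add: measurable_cong_sets[OF kern(2)[OF x] refl])
  have m2: "(\<lambda>y. kern P (d (Suc t) y) y) \<in> S \<rightarrow>\<^sub>M subprob_algebra S"
    using measurable_prob_algebraD[OF step_measurable] d by simp
  show ?case
    unfolding state_law.simps(2)[of P d x "Suc t"] Suc
    by (subst bind_assoc[OF m1 m2]) simp
qed

text \<open>The drift condition is iterated along the process. The nonnegative integral is used
  because integrability of \<open>w\<close> is only derived from this bound.\<close>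

lemma nn_integral_w_le:
  assumes d: "rule_measurable d" and x: "x \<in> X"
  shows "ennreal (\<beta> ^ t) * (\<integral>\<^sup>+y. ennreal (w y) \<partial>state_law P d x t) \<le> ennreal (\<gamma> ^ t * w x)"
proof (induction t)
  case 0
  then show ?case
    using x w_measurable by (simp add: nn_integral_return space_state_space)
next
  case (Suc t)
  let ?L = "state_law P d x t"
  have wS: "(\<lambda>y. ennreal (w y)) \<in> borel_measurable S"
    using w_measurable by simp
  have mL: "f \<in> borel_measurable ?L \<longleftrightarrow> f \<in> borel_measurable S" for f :: "real \<Rightarrow> ennreal"
    by (simp add: measurable_cong_sets[OF state_law(2)[OF d x] refl])
  have mk: "(\<lambda>y. \<integral>\<^sup>+u. w u \<partial>kern P (d t y) y) \<in> borel_measurable ?L"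
    by (rule measurable_compose[OF state_law_Suc_measurable[OF d x]
          nn_integral_measurable_subprob_algebra[OF wS]])
  have "ennreal (\<beta> ^ Suc t) * (\<integral>\<^sup>+y. w y \<partial>state_law P d x (Suc t))
      = ennreal (\<beta> ^ t) * (ennreal \<beta> * (\<integral>\<^sup>+y. \<integral>\<^sup>+u. w u \<partial>kern P (d t y) y \<partial>?L))"
    using \<beta>_nonneg
    by (simp add: nn_integral_bind[OF wS state_law_Suc_measurable[OF d x]] ennreal_mult ac_simps)
  also have "\<dots> = ennreal (\<beta> ^ t) * (\<integral>\<^sup>+y. ennreal \<beta> * (\<integral>\<^sup>+u. w u \<partial>kern P (d t y) y) \<partial>?L)"
    using mk by (simp add: nn_integral_cmult)
  also have "\<dots> \<le> ennreal (\<beta> ^ t) * (\<integral>\<^sup>+y. ennreal (\<gamma> * w y) \<partial>?L)"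
    by (intro mult_left_mono nn_integral_mono drift) (simp_all add: state_law(3)[OF d x])
  also have "(\<integral>\<^sup>+y. ennreal (\<gamma> * w y) \<partial>?L) = ennreal \<gamma> * (\<integral>\<^sup>+y. w y \<partial>?L)"
    using wS \<gamma>_nonneg w_nonneg
    by (subst nn_integral_cmult[symmetric]) (auto simp: mL state_law(3)[OF d x] ennreal_mult intro!: nn_integral_cong)
  also have "ennreal (\<beta> ^ t) * (ennreal \<gamma> * (\<integral>\<^sup>+y. w y \<partial>?L))
      = ennreal \<gamma> * (ennreal (\<beta> ^ t) * (\<integral>\<^sup>+y. w y \<partial>?L))"
    by (simp add: ac_simps)
  also have "\<dots> \<le> ennreal \<gamma> * ennreal (\<gamma> ^ t * w x)"
    by (rule mult_left_mono[OF Suc]) simp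
  also have "\<dots> = ennreal (\<gamma> ^ Suc t * w x)"
    using \<gamma>_nonneg w_nonneg[OF x] by (simp add: ennreal_mult[symmetric] ac_simps)
  finally show ?case .
qed

text \<open>For discount factor \<open>0\<close> the drift condition is vacuous and \<open>w\<close> need not be integrable against
  the later state laws; hence the hypothesis \<open>\<beta> ^ t \<noteq> 0\<close> here and below.\<close>

lemma integrable_w:
  assumes d: "rule_measurable d" and x: "x \<in> X" and nz: "\<beta> ^ t \<noteq> 0"
  shows "integrable (state_law P d x t) w"
    and "\<beta> ^ t * (\<integral>y. w y \<partial>state_law P d x t) \<le> \<gamma> ^ t * w x"
proof -
  let ?L = "state_law P d x t"
  have pos: "0 < \<beta> ^ t" using zero_le_power[OF \<beta>_nonneg] nz[symmetric] by (rule le_neq_trans)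
  have nn: "AE y in ?L. 0 \<le> w y"
    by (rule AE_I2) (simp add: state_law(3)[OF d x] w_nonneg)
  have wL: "w \<in> borel_measurable ?L"
    using w_measurable by (simp add: measurable_cong_sets[OF state_law(2)[OF d x] refl])
  have "ennreal (\<beta> ^ t) * (\<integral>\<^sup>+y. w y \<partial>?L) < \<infinity>"
    using nn_integral_w_le[OF d x, of t] by (rule le_less_trans) simp
  then have fin: "(\<integral>\<^sup>+y. w y \<partial>?L) < \<infinity>"
    using pos unfolding ennreal_mult_less_top infinity_ennreal_def
    by (metis ennreal_eq_0_iff ennreal_zero_less_top not_le)
  show i: "integrable ?L w"
    by (rule integrableI_nonneg[OF wL nn fin])
  have "ennreal (\<beta> ^ t * (\<integral>y. w y \<partial>?L)) = ennreal (\<beta> ^ t) * (\<integral>\<^sup>+y. w y \<partial>?L)"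
    using pos by (subst nn_integral_eq_integral[OF i nn]) (rule ennreal_mult', simp)
  also have "\<dots> \<le> ennreal (\<gamma> ^ t * w x)" by (rule nn_integral_w_le[OF d x])
  finally have "ennreal (\<beta> ^ t * (\<integral>y. w y \<partial>?L)) \<le> ennreal (\<gamma> ^ t * w x)" .
  moreover have "0 \<le> \<gamma> ^ t * w x"
    using \<gamma>_nonneg w_nonneg[OF x] by simp
  ultimately show "\<beta> ^ t * (\<integral>y. w y \<partial>?L) \<le> \<gamma> ^ t * w x"
    by (rule iffD1[OF ennreal_le_iff, rotated])
qed

lemma integrable_dominated:
  assumes d: "rule_measurable d" and x: "x \<in> X" and nz: "\<beta> ^ t \<noteq> 0" and h: "dominated C h"
  shows "integrable (state_law P d x t) h"
proof (rule Bochner_Integration.integrable_bound)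
  show "integrable (state_law P d x t) (\<lambda>y. C * w y)"
    using integrable_w(1)[OF d x nz] by simp
  show "h \<in> borel_measurable (state_law P d x t)"
    using h by (simp add: dominated_def measurable_cong_sets[OF state_law(2)[OF d x] refl])
  show "AE y in state_law P d x t. norm (h y) \<le> norm (C * w y)"
  proof (rule AE_I2)
    fix y assume "y \<in> space (state_law P d x t)"
    then have "y \<in> X" by (simp add: state_law(3)[OF d x])
    then have "\<bar>h y\<bar> \<le> C * w y" using h by (simp add: dominated_def)
    then show "norm (h y) \<le> norm (C * w y)" by simp
  qed
qed

text \<open>Geometric decay at rate \<gamma>: every later exchange of a sum with an integral or a
  limit rests on this majorant.\<close>

lemma integral_dominated_le:
  assumes d: "rule_measurable d" and x: "x \<in> X" and h: "dominated C h"
  shows "\<bar>\<beta> ^ t * (\<integral>y. h y \<partial>state_law P d x t)\<bar> \<le> C * w x * \<gamma> ^ t"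
proof (cases "\<beta> ^ t = 0")
  case True
  then show ?thesis
    unfolding True using h \<gamma>_nonneg w_nonneg[OF x] by (simp add: dominated_def)
next
  case False
  let ?L = "state_law P d x t"
  have "\<bar>\<integral>y. h y \<partial>?L\<bar> \<le> (\<integral>y. \<bar>h y\<bar> \<partial>?L)"
    by (rule integral_abs_bound)
  also have "\<dots> \<le> (\<integral>y. C * w y \<partial>?L)"
    using h integrable_dominated[OF d x False h] integrable_w(1)[OF d x False]
    by (intro integral_mono) (auto simp: dominated_def state_law(3)[OF d x])
  also have "\<dots> = C * (\<integral>y. w y \<partial>?L)" by simp
  finally have "\<beta> ^ t * \<bar>\<integral>y. h y \<partial>?L\<bar> \<le> \<beta> ^ t * (C * (\<integral>y. w y \<partial>?L))"
    using \<beta>_nonneg by (intro mult_left_mono) auto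
  also have "\<dots> = C * (\<beta> ^ t * (\<integral>y. w y \<partial>?L))" by simp
  also have "\<dots> \<le> C * (\<gamma> ^ t * w x)"
    using h by (intro mult_left_mono integrable_w(2)[OF d x False]) (simp add: dominated_def)
  finally show ?thesis
    using \<beta>_nonneg by (simp add: abs_mult ac_simps)
qed

lemma geometric_\<gamma>: "(\<lambda>t. C * \<gamma> ^ t) sums (C / (1 - \<gamma>))"
  using sums_mult[OF geometric_sums[of \<gamma>], of C] \<gamma>_nonneg \<gamma>_less_1 by simp

lemma cost_rule:
  assumes q: "cost C q" and b: "Measurable.pred S b"
  shows "dominated C (\<lambda>y. q y (b y))"
proof -
  have [measurable]: "(\<lambda>y. q y a) \<in> borel_measurable S" for a
    using q by (simp add: cost_def dominated_def)
  note b[measurable]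
  have "(\<lambda>y. q y (b y)) = (\<lambda>y. if b y then q y True else q y False)" by auto
  moreover have "(\<lambda>y. if b y then q y True else q y False) \<in> borel_measurable S" by measurable
  ultimately show ?thesis
    using q by (auto simp: cost_def dominated_def)
qed

lemma val_summable:
  assumes "rule_measurable d" "x \<in> X" "cost C q"
  shows "summable (\<lambda>t. disc P ^ t * (\<integral>y. q y (d t y) \<partial>state_law P d x t))"
    and "\<bar>val P q d x\<bar> \<le> C / (1 - \<gamma>) * w x"
proof -
  have le: "norm (\<beta> ^ t * (\<integral>y. q y (d t y) \<partial>state_law P d x t)) \<le> C * w x * \<gamma> ^ t" for t
    using integral_dominated_le[OF assms(1,2) cost_rule[OF assms(3)], of "d t"] assms(1) by simp
  note g = geometric_\<gamma>[of "C * w x"]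
  show "summable (\<lambda>t. disc P ^ t * (\<integral>y. q y (d t y) \<partial>state_law P d x t))"
    by (rule summable_comparison_test'[OF sums_summable[OF g] le])
  have "\<bar>val P q d x\<bar> \<le> C * w x / (1 - \<gamma>)"
    using norm_suminf_le[OF le sums_summable[OF g]] sums_unique[OF g] by (simp add: val_def)
  then show "\<bar>val P q d x\<bar> \<le> C / (1 - \<gamma>) * w x" by simp
qed

text \<open>Value functions stay in the weighted space, with the norm multiplied by the sum of the
  geometric series. So they can themselves be integrated against kernels and state laws.\<close>

lemma dominated_val:
  assumes d: "rule_measurable d" and q: "cost C q"
  shows "dominated (C / (1 - \<gamma>)) (val P q d)"
proof -
  have "(\<lambda>y. q y (d t y)) \<in> borel_measurable S" for t
    using cost_rule[OF q, of "d t"] d by (simp add: dominated_def)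
  from integral_measurable_subprob_algebra[OF this]
  have "(\<lambda>x. \<beta> ^ t * (\<integral>y. q y (d t y) \<partial>state_law P d x t)) \<in> borel_measurable S" for t
    using measurable_compose[OF measurable_prob_algebraD[OF state_law_measurable[OF d]]]
    by (intro borel_measurable_times borel_measurable_const) blast
  then have "(\<lambda>x. val P q d x) \<in> borel_measurable S"
    unfolding val_def by (intro borel_measurable_suminf)
  then show ?thesis
    using val_summable(2)[OF d _ q] q \<gamma>_less_1
    by (auto simp: dominated_def cost_def)
qed

lemma integrable_kern:
  assumes x: "x \<in> X" and nz: "\<beta> \<noteq> 0" and h: "dominated C h"
  shows "integrable (kern P a x) h"
proof -
  \<comment> \<open>A single kernel is the state law at time 1 of a constant rule, so the estimates
    for state laws apply to it.\<close>
  have "state_law P (\<lambda>_ _. a) x 1 = kern P a x"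
    using measurable_prob_algebraD[OF kern_measurable, of a] x
    by (simp add: bind_return[where N=S] space_state_space)
  then show ?thesis
    using integrable_dominated[of "\<lambda>_ _. a" x 1 C h] assms by auto
qed

section \<open>From the path law to the state laws\<close>

text \<open>Under a deterministic Markov rule the next pair depends on the past only through the
  last pair. Hence the coordinate laws obey the recursion that defines \<open>state_law\<close>,
  transported along the graph of the rule.\<close>

lemma law_component:
  assumes d: "rule_measurable d" and x: "x \<in> X"
  shows "distr (law P x (markov d)) (step_space P) (\<lambda>\<omega>. \<omega> t) =
      distr (state_law P d x t) (step_space P) (\<lambda>y. (y, d t y))"
proof -
  interpret IT: Ionescu_Tulcea "next_step P x (markov d)" "\<lambda>_. step_space P"
    using wf markov_nonanticipative x d by (intro next_step_Ionescu_Tulcea) auto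
  have law: "law P x (markov d) = IT.PF.lim" by (simp add: law_def)
  have pair: "(\<lambda>y. (y, d t y)) \<in> S \<rightarrow>\<^sub>M step_space P" for t
    unfolding step_space_def using d by (intro measurable_Pair measurable_ident) auto
  \<comment> \<open>The action is a point mass at \<open>d t y\<close>, so drawing it after the
    state amounts to mapping the state to the graph of \<open>d t\<close>.\<close>
  have next_step: "next_step P x (markov d) t h = distr N (step_space P) (\<lambda>y. (y, d t y))"
    if "next_state P x t h = N" "sets N = sets S" "space N \<noteq> {}" for t h N
  proof -
    have "return (count_space UNIV) (d t y) \<bind> (\<lambda>a. return (step_space P) (y, a))
        = return (step_space P) (y, d t y)" if "y \<in> space N" for y
    proof (rule bind_return[where N="step_space P"])
      have "y \<in> space S" using that \<open>sets N = sets S\<close> sets_eq_imp_space_eq by blast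
      then show "(\<lambda>a. return (step_space P) (y, a)) \<in> count_space UNIV \<rightarrow>\<^sub>M subprob_algebra (step_space P)"
        by (intro measurable_compose[OF _ return_measurable]) (auto simp: step_space_def space_pair_measure)
    qed simp
    then have "next_step P x (markov d) t h = N \<bind> (\<lambda>y. return (step_space P) (y, d t y))"
      unfolding next_step_def markov_def that(1) by (intro bind_cong) auto
    also have "\<dots> = distr N (step_space P) (\<lambda>y. (y, d t y))"
      using that(2,3) pair by (intro bind_return_distr') (simp_all add: measurable_cong_sets[OF that(2) refl])
    finally show ?thesis .
  qed
  let ?past = "\<lambda>n. PiM {0..<n} (\<lambda>_. step_space P)"
  have restr: "(\<lambda>\<omega>. restrict \<omega> {0..<n}) \<in> IT.PF.lim \<rightarrow>\<^sub>M ?past n" for n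
    by (auto simp: measurable_cong_sets[OF IT.PF.sets_lim refl] intro!: measurable_restrict measurable_component_singleton)
  have past_prob: "prob_space (distr IT.PF.lim (?past n) (\<lambda>\<omega>. restrict \<omega> {0..<n}))" for n
    using IT.PF.prob_space_P[of "{0..<n}"] by (simp add: IT.distr_lim)
  show ?thesis
  proof (induction t)
    case 0
    let ?R = "distr (return S x) (step_space P) (\<lambda>y. (y, d 0 y))"
    have R: "subprob_space ?R"
      using x pair[of 0] by (intro prob_space_imp_subprob_space prob_space.prob_space_distr prob_space_return)
        (auto simp: space_state_space)
    have "distr IT.PF.lim (step_space P) (\<lambda>\<omega>. \<omega> 0)
        = distr IT.PF.lim (?past 0) (\<lambda>\<omega>. restrict \<omega> {0..<0}) \<bind> next_step P x (markov d) 0"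
      by (rule IT.distr_lim_component)
    also have "\<dots> = distr IT.PF.lim (?past 0) (\<lambda>\<omega>. restrict \<omega> {0..<0}) \<bind> (\<lambda>_. ?R)"
      by (intro bind_cong refl next_step) (use x in \<open>auto simp: next_state_def space_state_space\<close>)
    also have "\<dots> = ?R"
      by (rule bind_const'[OF past_prob R])
    finally show ?case by (simp add: law)
  next
    case (Suc n)
    let ?f = "\<lambda>y. (y, d (Suc n) y)"
    let ?K = "\<lambda>p. distr (kern P (snd p) (fst p)) (step_space P) ?f"
    let ?Q = "distr IT.PF.lim (?past (Suc n)) (\<lambda>\<omega>. restrict \<omega> {0..<Suc n})"
    have K: "?K \<in> step_space P \<rightarrow>\<^sub>M subprob_algebra (step_space P)"
    proof -
      have "(\<lambda>p. kern P (snd p) (fst p)) \<in> step_space P \<rightarrow>\<^sub>M prob_algebra S"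
        unfolding step_space_def
        by (rule measurable_compose_countable'[where I=UNIV and g=snd and f="\<lambda>a p. kern P a (fst p)"])
           (auto intro: measurable_compose[OF measurable_fst kern_measurable])
      from measurable_compose[OF this measurable_distr_prob_space[OF pair]]
      show ?thesis by (rule measurable_prob_algebraD)
    qed
    have comp: "(\<lambda>h. h n) \<in> ?Q \<rightarrow>\<^sub>M step_space P"
      by (simp add: measurable_component_singleton)
    have neQ: "space ?Q \<noteq> {}" by (rule prob_space.not_empty[OF past_prob])
    have "distr IT.PF.lim (step_space P) (\<lambda>\<omega>. \<omega> (Suc n)) = ?Q \<bind> next_step P x (markov d) (Suc n)"
      by (rule IT.distr_lim_component)
    \<comment> \<open>Only coordinate \<open>n\<close> of the past is used, which lets the past be
      replaced by its marginal and the induction hypothesis be applied.\<close>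
    also have "\<dots> = ?Q \<bind> (\<lambda>h. ?K (h n))"
    proof (intro bind_cong refl next_step)
      fix h assume "h \<in> space ?Q"
      then have "h n \<in> space (step_space P)" by (auto simp: space_PiM PiE_iff)
      then have "fst (h n) \<in> states P" by (auto simp: step_space_def space_pair_measure space_state_space)
      then show "sets (kern P (snd (h n)) (fst (h n))) = sets S" "space (kern P (snd (h n)) (fst (h n))) \<noteq> {}"
        using kern(2,3) by auto
    qed (simp add: next_state_def)
    also have "\<dots> = distr ?Q (step_space P) (\<lambda>h. h n) \<bind> ?K"
      by (rule bind_distr[symmetric, OF comp K neQ])
    also have "distr ?Q (step_space P) (\<lambda>h. h n) = distr IT.PF.lim (step_space P) (\<lambda>\<omega>. \<omega> n)"
      using comp by (subst distr_distr[OF _ restr]) (auto simp: comp_def)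
    also have "\<dots> = distr (state_law P d x n) (step_space P) (\<lambda>y. (y, d n y))"
      using Suc by (simp add: law)
    also have "\<dots> \<bind> ?K = state_law P d x n \<bind> (\<lambda>y. ?K (y, d n y))"
      by (rule bind_distr[OF _ K])
         (use pair x in \<open>auto simp: measurable_cong_sets[OF state_law(2)[OF d x] refl] state_law(3)[OF d x]\<close>)
    also have "\<dots> = distr (state_law P d x (Suc n)) (step_space P) ?f"
      unfolding state_law.simps
      by (subst distr_bind[OF state_law_Suc_measurable[OF d x] _ pair])
         (use x in \<open>auto simp: state_law(3)[OF d x]\<close>)
    finally show ?case by (simp add: law)
  qed
qed

lemma sets_law:
  assumes "rule_measurable d" "x \<in> X"
  shows "sets (law P x (markov d)) = sets (PiM UNIV (\<lambda>_. step_space P))"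
proof -
  interpret IT: Ionescu_Tulcea "next_step P x (markov d)" "\<lambda>_. step_space P"
    using wf markov_nonanticipative assms by (intro next_step_Ionescu_Tulcea) auto
  show ?thesis by (simp add: law_def)
qed

lemma component_measurable:
  assumes "rule_measurable d" "x \<in> X"
  shows "(\<lambda>\<omega>. \<omega> t) \<in> law P x (markov d) \<rightarrow>\<^sub>M step_space P"
  by (simp add: measurable_cong_sets[OF sets_law[OF assms] refl] measurable_component_singleton)

lemma pair_measurable:
  assumes "rule_measurable d" "x \<in> X"
  shows "(\<lambda>y. (y, d t y)) \<in> state_law P d x t \<rightarrow>\<^sub>M step_space P"
proof -
  have "(\<lambda>y. (y, d t y)) \<in> S \<rightarrow>\<^sub>M step_space P"
    unfolding step_space_def using assms(1) by (intro measurable_Pair measurable_ident) auto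
  then show ?thesis by (simp add: measurable_cong_sets[OF state_law(2)[OF assms] refl])
qed

text \<open>The image of \<open>law\<close> under the time-zero coordinate is a probability measure,
  and images preserve total mass.\<close>

lemma prob_space_law:
  assumes "rule_measurable d" "x \<in> X"
  shows "prob_space (law P x (markov d))"
  using prob_space.prob_space_distr[OF state_law(1)[OF assms] pair_measurable[OF assms, of 0]]
  by (intro prob_space_distrD[OF component_measurable[OF assms, of 0]]) (simp add: law_component[OF assms])

lemma AE_law_component:
  assumes d: "rule_measurable d" and x: "x \<in> X" and A: "A \<in> sets borel"
    and AE: "AE \<omega> in law P x (markov d). fst (\<omega> t) \<in> A"
  shows "AE y in state_law P d x t. y \<in> A"
proof -
  have A': "A \<inter> X \<in> sets S" using A states_borel by (auto simp: sets_state_space_iff)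
  have meas: "{p \<in> space (step_space P). fst p \<in> A} \<in> sets (step_space P)"
  proof -
    have "{p \<in> space (step_space P). fst p \<in> A} = fst -` (A \<inter> X) \<inter> space (step_space P)"
      by (auto simp: step_space_def space_pair_measure space_state_space)
    also have "\<dots> \<in> sets (step_space P)"
      using A' unfolding step_space_def by (intro measurable_sets[OF measurable_fst])
    finally show ?thesis .
  qed
  have "AE p in distr (law P x (markov d)) (step_space P) (\<lambda>\<omega>. \<omega> t). fst p \<in> A"
    using AE by (subst AE_distr_iff[OF component_measurable[OF d x] meas])
  then show ?thesis
    unfolding law_component[OF d x] by (subst (asm) AE_distr_iff[OF pair_measurable[OF d x] meas]) simp
qed

text \<open>The series may be integrated term by term because the expected absolute values are
  summable; each term then depends on a single coordinate and transfers to the state law.\<close>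

lemma law_integral:
  assumes d: "rule_measurable d" and x: "x \<in> X" and q: "cost C q"
  shows "(\<integral>\<omega>. (\<Sum>t. disc P ^ t * q (fst (\<omega> t)) (snd (\<omega> t))) \<partial>law P x (markov d)) = val P q d x"
proof -
  let ?L = "law P x (markov d)"
  let ?q = "\<lambda>p. q (fst p) (snd p)"
  let ?f = "\<lambda>t \<omega>. \<beta> ^ t * ?q (\<omega> t)"
  have q1: "(\<lambda>y. q y a) \<in> borel_measurable S" for a
    using q by (simp add: cost_def dominated_def)
  have qm: "?q \<in> borel_measurable (step_space P)"
    unfolding step_space_def
    by (rule measurable_compose_countable'[where I=UNIV and g=snd and f="\<lambda>a p. q (fst p) a"])
       (auto intro: measurable_compose[OF measurable_fst q1])
  have transfer: "(\<integral>\<omega>. g (\<omega> t) \<partial>?L) = (\<integral>y. g (y, d t y) \<partial>state_law P d x t)"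
      "integrable ?L (\<lambda>\<omega>. g (\<omega> t)) \<longleftrightarrow> integrable (state_law P d x t) (\<lambda>y. g (y, d t y))"
    if g: "g \<in> borel_measurable (step_space P)" for t and g :: "real \<times> bool \<Rightarrow> real"
    using law_component[OF d x, of t]
      integral_distr[OF component_measurable[OF d x, of t] g] integral_distr[OF pair_measurable[OF d x, of t] g]
      integrable_distr_eq[OF component_measurable[OF d x, of t] g] integrable_distr_eq[OF pair_measurable[OF d x, of t] g]
    by simp_all
  have qd: "dominated C (\<lambda>y. q y (d t y))" for t
    using cost_rule[OF q] d by blast
  have qd': "dominated C (\<lambda>y. \<bar>q y (d t y)\<bar>)" for t
    using qd[of t] borel_measurable_abs[of "\<lambda>y. q y (d t y)" S] by (simp add: dominated_def)
  have int: "integrable ?L (?f t)" for t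
  proof (cases "\<beta> ^ t = 0")
    case False
    then show ?thesis
      using transfer(2)[OF qm, of t] integrable_dominated[OF d x False qd[of t]] by simp
  qed (simp only: mult_zero_left integrable_zero)
  have norm_int: "(\<integral>\<omega>. norm (?f t \<omega>) \<partial>?L) = \<beta> ^ t * (\<integral>y. \<bar>q y (d t y)\<bar> \<partial>state_law P d x t)" for t
    using transfer(1)[of "\<lambda>p. \<bar>?q p\<bar>" t] qm \<beta>_nonneg by (simp add: abs_mult)
  have le: "(\<integral>\<omega>. norm (?f t \<omega>) \<partial>?L) \<le> C * w x * \<gamma> ^ t" for t
    using integral_dominated_le[OF d x qd'[of t], of t] unfolding norm_int by simp
  have summ: "summable (\<lambda>t. \<integral>\<omega>. norm (?f t \<omega>) \<partial>?L)"
    by (rule summable_comparison_test'[OF sums_summable[OF geometric_\<gamma>[of "C * w x"]]])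
       (use le in simp)
  \<comment> \<open>The expected sum of absolute values is finite, so almost every path has an
    absolutely convergent series.\<close>
  have "(\<integral>\<^sup>+\<omega>. (\<Sum>t. ennreal (norm (?f t \<omega>))) \<partial>?L) = (\<Sum>t. \<integral>\<^sup>+\<omega>. ennreal (norm (?f t \<omega>)) \<partial>?L)"
    using borel_measurable_integrable[OF int] by (intro nn_integral_suminf) simp
  also have "\<dots> = (\<Sum>t. ennreal (\<integral>\<omega>. norm (?f t \<omega>) \<partial>?L))"
    by (intro suminf_cong nn_integral_eq_integral integrable_norm int) simp
  also have "\<dots> = ennreal (\<Sum>t. \<integral>\<omega>. norm (?f t \<omega>) \<partial>?L)"
    by (rule suminf_ennreal2[OF _ summ]) simp
  finally have "(\<integral>\<^sup>+\<omega>. (\<Sum>t. ennreal (norm (?f t \<omega>))) \<partial>?L) \<noteq> \<infinity>" by simp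
  then have "AE \<omega> in ?L. (\<Sum>t. ennreal (norm (?f t \<omega>))) \<noteq> \<infinity>"
    using borel_measurable_integrable[OF int] by (intro nn_integral_PInf_AE borel_measurable_suminf_order) auto
  then have AE: "AE \<omega> in ?L. summable (\<lambda>t. norm (?f t \<omega>))"
    by eventually_elim (rule summable_suminf_not_top, auto)
  have "(\<integral>\<omega>. (\<Sum>t. ?f t \<omega>) \<partial>?L) = (\<Sum>t. \<integral>\<omega>. ?f t \<omega> \<partial>?L)"
    by (rule integral_suminf[OF int AE summ])
  also have "\<dots> = val P q d x"
    unfolding val_def using transfer(1)[OF qm] by simp
  finally show ?thesis .
qed

subsection \<open>Performance differences of stationary rules\<close>

lemma rule_measurable_case_nat:
  assumes "rule_measurable d"
  shows "rule_measurable (case_nat (\<lambda>_. a) d)"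
  using assms by (auto split: nat.split)

text \<open>First-step analysis: the later state laws are mixtures, over the first transition, of
  state laws of the shifted rule, and the sum over time is exchanged with that mixture.\<close>

lemma val_Bellman:
  assumes d: "rule_measurable d" and x: "x \<in> X" and q: "cost C q"
  shows "val P q d x = q x (d 0 x) + \<beta> * (\<integral>y. val P q (\<lambda>t. d (Suc t)) y \<partial>kern P (d 0 x) x)"
proof -
  let ?K = "kern P (d 0 x) x" and ?d = "\<lambda>t. d (Suc t)"
  have d': "rule_measurable ?d" using d by simp
  let ?c = "\<lambda>t y. \<beta> ^ t * (\<integral>u. q u (?d t u) \<partial>state_law P ?d y t)"
  have qd: "dominated C (\<lambda>y. q y (d t y))" for t
    using cost_rule[OF q] d by blast
  have q0: "(\<lambda>y. q y (d 0 y)) \<in> borel_measurable S" using qd[of 0] by (simp add: dominated_def)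
  have "val P q d x = (\<Sum>t. \<beta> ^ Suc t * (\<integral>y. q y (d (Suc t) y) \<partial>state_law P d x (Suc t)))
      + (\<integral>y. q y (d 0 y) \<partial>state_law P d x 0)"
    unfolding val_def using suminf_split_head[OF val_summable(1)[OF d x q]] by simp
  also have "(\<integral>y. q y (d 0 y) \<partial>state_law P d x 0) = q x (d 0 x)"
    using x q0 by (simp add: integral_return space_state_space)
  also have "(\<Sum>t. \<beta> ^ Suc t * (\<integral>y. q y (d (Suc t) y) \<partial>state_law P d x (Suc t)))
      = \<beta> * (\<integral>y. val P q ?d y \<partial>?K)"
  proof (cases "\<beta> = 0")
    case False
    have term_eq: "\<beta> ^ Suc t * (\<integral>y. q y (d (Suc t) y) \<partial>state_law P d x (Suc t)) = \<beta> * (\<integral>y. ?c t y \<partial>?K)" for t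
    proof -
      have N: "(\<lambda>y. state_law P ?d y t) \<in> ?K \<rightarrow>\<^sub>M subprob_algebra S"
        using measurable_prob_algebraD[OF state_law_measurable[OF d']]
        by (simp add: measurable_cong_sets[OF kern(2)[OF x] refl])
      have "(\<integral>y. q y (d (Suc t) y) \<partial>state_law P d x (Suc t)) =
          (\<integral>y. (\<integral>u. q u (d (Suc t) u) \<partial>state_law P ?d y t) \<partial>?K)"
        unfolding state_law_Suc_left[OF d x]
      proof (rule integral_bind_integrable(2)[OF N])
        show "space ?K \<noteq> {}" using x by (auto simp: kern(3)[OF x])
        show "integrable (?K \<bind> (\<lambda>y. state_law P ?d y t)) (\<lambda>y. q y (d (Suc t) y))"
          using integrable_dominated[OF d x _ qd, of "Suc t"] False by (simp add: state_law_Suc_left[OF d x] del: state_law.simps)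
        show "integrable (state_law P ?d y t) (\<lambda>y. q y (d (Suc t) y))" if "y \<in> space ?K" for y
          using integrable_dominated[OF d' _ _ qd] that False by (simp add: kern(3)[OF x])
      qed
      then show ?thesis by (simp del: state_law.simps)
    qed
    \<comment> \<open>The terms decay geometrically in the weighted norm, which supplies the
      majorant for exchanging the series with the kernel integral.\<close>
    have cd: "dominated (C * \<gamma> ^ t) (?c t)" for t
    proof -
      have "(\<lambda>y. q y (?d t y)) \<in> borel_measurable S"
        using qd[of "Suc t"] by (simp add: dominated_def)
      from measurable_compose[OF measurable_prob_algebraD[OF state_law_measurable[OF d']]
          integral_measurable_subprob_algebra[OF this]]
      have "?c t \<in> borel_measurable S"
        by (intro borel_measurable_times borel_measurable_const)
      moreover have "\<bar>?c t y\<bar> \<le> C * \<gamma> ^ t * w y" if "y \<in> X" for y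
        using integral_dominated_le[OF d' that qd[of "Suc t"], of t] by (simp add: ac_simps)
      ultimately show ?thesis
        using qd[of 0] \<gamma>_nonneg by (simp add: dominated_def)
    qed
    have int: "integrable ?K (?c t)" for t
      by (rule integrable_kern[OF x False cd])
    have w_dom: "dominated 1 w"
      using w_measurable w_nonneg by (simp add: dominated_def)
    have norm_le: "norm (\<integral>y. norm (?c t y) \<partial>?K) \<le> C * (\<integral>y. w y \<partial>?K) * \<gamma> ^ t" for t
    proof -
      have "(\<integral>y. norm (?c t y) \<partial>?K) \<le> (\<integral>y. C * \<gamma> ^ t * w y \<partial>?K)"
        using int[of t] integrable_kern[OF x False w_dom] cd[of t]
        by (intro integral_mono integrable_norm) (auto simp: dominated_def kern(3)[OF x])
      then show ?thesis by (simp add: ac_simps)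
    qed
    have AE: "AE y in ?K. summable (\<lambda>t. norm (?c t y))"
    proof (rule AE_I2)
      fix y assume "y \<in> space ?K"
      then have y: "y \<in> X" by (simp add: kern(3)[OF x])
      show "summable (\<lambda>t. norm (?c t y))"
        by (rule summable_comparison_test'[OF sums_summable[OF geometric_\<gamma>[of "C * w y"]]])
           (use integral_dominated_le[OF d' y qd] in simp)
    qed
    have summ: "summable (\<lambda>t. \<integral>y. norm (?c t y) \<partial>?K)"
      by (rule summable_comparison_test'[OF sums_summable[OF geometric_\<gamma>] norm_le])
    have "(\<Sum>t. \<beta> * (\<integral>y. ?c t y \<partial>?K)) = \<beta> * (\<Sum>t. \<integral>y. ?c t y \<partial>?K)"
      by (rule suminf_mult[OF summable_integral[OF int AE summ]])
    also have "(\<Sum>t. \<integral>y. ?c t y \<partial>?K) = (\<integral>y. (\<Sum>t. ?c t y) \<partial>?K)"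
      by (rule integral_suminf[symmetric, OF int AE summ])
    finally show ?thesis unfolding term_eq val_def .
  qed simp
  finally show ?thesis by simp
qed

lemma dominated_advantage:
  assumes b: "Measurable.pred S b" and q: "cost C q"
  shows "dominated (2 * C / (1 - \<gamma>)) (advantage P q b)"
proof -
  have "dominated (C / (1 - \<gamma>)) (val P q (case_nat (\<lambda>_. a) (\<lambda>_. b)))" for a
    by (rule dominated_val[OF rule_measurable_case_nat q]) (use b in simp)
  note T = this[of True] and F = this[of False]
  have "\<bar>advantage P q b x\<bar> \<le> 2 * C / (1 - \<gamma>) * w x" if "x \<in> X" for x
  proof -
    have "\<bar>val P q (case_nat (\<lambda>_. a) (\<lambda>_. b)) x\<bar> \<le> C / (1 - \<gamma>) * w x" for a
      using T F that by (cases a) (simp_all only: dominated_def)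
    note this[of True] this[of False]
    then have "\<bar>advantage P q b x\<bar> \<le> C / (1 - \<gamma>) * w x + C / (1 - \<gamma>) * w x"
      unfolding advantage_def by linarith
    then show ?thesis by (simp add: add_divide_distrib[symmetric] mult.assoc)
  qed
  moreover have "advantage P q b \<in> borel_measurable S"
    using T F unfolding dominated_def advantage_def[abs_def] by (intro borel_measurable_diff) blast+
  moreover have "0 \<le> 2 * C / (1 - \<gamma>)"
    using q \<gamma>_less_1 by (simp add: cost_def dominated_def)
  ultimately show ?thesis by (simp add: dominated_def)
qed

text \<open>The gain from using \<open>b\<close> for one step and \<open>b'\<close> afterwards,
  compared with \<open>b'\<close> throughout.\<close>

definition switch_gain :: "(real \<Rightarrow> bool \<Rightarrow> real) \<Rightarrow> (real \<Rightarrow> bool) \<Rightarrow> (real \<Rightarrow> bool) \<Rightarrow> real \<Rightarrow> real" where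
  "switch_gain q b b' y = (of_bool (b y) - of_bool (b' y)) * advantage P q b' y"

lemma dominated_switch_gain:
  assumes b: "Measurable.pred S b" and b': "Measurable.pred S b'" and q: "cost C q"
  shows "dominated (2 * C / (1 - \<gamma>)) (switch_gain q b b')"
proof -
  note adv = dominated_advantage[OF b' q]
  have [measurable]: "advantage P q b' \<in> borel_measurable S"
    using adv by (simp add: dominated_def)
  note b[measurable] b'[measurable]
  have "(\<lambda>y. (of_bool (b y) - of_bool (b' y)) * advantage P q b' y :: real)
      = (\<lambda>y. if b y then (if b' y then 0 else advantage P q b' y) else (if b' y then - advantage P q b' y else 0))"
    by auto
  moreover have "\<dots> \<in> borel_measurable S" by measurable
  ultimately have "switch_gain q b b' \<in> borel_measurable S"
    by (simp add: switch_gain_def[abs_def])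
  moreover have "\<bar>switch_gain q b b' y\<bar> \<le> 2 * C / (1 - \<gamma>) * w y" if "y \<in> X" for y
  proof -
    have "\<bar>switch_gain q b b' y\<bar> \<le> \<bar>advantage P q b' y\<bar>"
      by (auto simp: switch_gain_def)
    also have "\<dots> \<le> 2 * C / (1 - \<gamma>) * w y" using adv that by (simp add: dominated_def)
    finally show ?thesis .
  qed
  ultimately show ?thesis using adv by (simp add: dominated_def)
qed

text \<open>The Bellman equation is applied to both choices of first action and to \<open>b'\<close>
  itself. This residual form is the one that telescopes along a trajectory of
  \<open>b\<close>.\<close>

lemma switch_gain_eq:
  assumes b': "Measurable.pred S b'" and q: "cost C q" and y: "y \<in> X"
  shows "switch_gain q b b' y =
    q y (b y) + \<beta> * (\<integral>u. val P q (\<lambda>_. b') u \<partial>kern P (b y) y) - val P q (\<lambda>_. b') y"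
proof -
  have first: "val P q (case_nat (\<lambda>_. a) (\<lambda>_. b')) y =
      q y a + \<beta> * (\<integral>u. val P q (\<lambda>_. b') u \<partial>kern P a y)" for a
    using val_Bellman[OF rule_measurable_case_nat y q, of "\<lambda>_. b'" a] b' by simp
  have "val P q (\<lambda>_. b') y = q y (b' y) + \<beta> * (\<integral>u. val P q (\<lambda>_. b') u \<partial>kern P (b' y) y)"
    using val_Bellman[OF _ y q, of "\<lambda>_. b'"] b' by simp
  then show ?thesis
    by (cases "b y"; cases "b' y") (simp_all add: switch_gain_def advantage_def first)
qed

text \<open>Summing the Bellman residuals of the value of \<open>b'\<close> along the state laws of
  \<open>b\<close> leaves the value of \<open>b\<close> and a telescoping series, whose boundary
  terms are minus the value of \<open>b'\<close> at \<open>x\<close> and a vanishing tail.\<close>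

lemma performance_difference:
  assumes b: "Measurable.pred S b" and b': "Measurable.pred S b'" and q: "cost C q" and x: "x \<in> X"
  shows "(\<lambda>t. \<beta> ^ t * (\<integral>y. switch_gain q b b' y \<partial>state_law P (\<lambda>_. b) x t))
    sums (val P q (\<lambda>_. b) x - val P q (\<lambda>_. b') x)"
proof -
  let ?d = "\<lambda>_::nat. b" and ?V = "val P q (\<lambda>_. b')"
  let ?L = "state_law P ?d x"
  have d: "rule_measurable ?d" and d': "rule_measurable (\<lambda>_::nat. b')" using b b' by auto
  let ?a = "\<lambda>t. \<beta> ^ t * (\<integral>y. ?V y \<partial>?L t)" and ?r = "\<lambda>t. \<beta> ^ t * (\<integral>y. q y (b y) \<partial>?L t)"
  note V = dominated_val[OF d' q] and qb = cost_rule[OF q b]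
  have term_eq: "\<beta> ^ t * (\<integral>y. switch_gain q b b' y \<partial>?L t) = ?r t + (?a (Suc t) - ?a t)" for t
  proof (cases "\<beta> ^ t = 0")
    case True
    then have "\<beta> ^ Suc t = 0" by simp
    with True show ?thesis by (simp only: mult_zero_left)
  next
    case nz: False
    let ?KV = "\<lambda>y. \<integral>u. ?V u \<partial>kern P (b y) y"
    \<comment> \<open>At \<open>t = 0\<close> the power is 1 even for discount factor 0, and the
      value need not be integrable against the next law. The factor \<beta> then makes both claims
      trivial.\<close>
    have KV: "integrable (?L t) (\<lambda>y. \<beta> * ?KV y)" "(\<integral>y. \<beta> * ?KV y \<partial>?L t) = \<beta> * (\<integral>y. ?V y \<partial>?L (Suc t))"
    proof -
      have "integrable (?L t) ?KV \<and> (\<integral>y. ?V y \<partial>?L (Suc t)) = (\<integral>y. ?KV y \<partial>?L t)" if "\<beta> \<noteq> 0"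
      proof -
        have ne: "space (?L t) \<noteq> {}" using x by (auto simp: state_law(3)[OF d x])
        have "\<beta> ^ Suc t \<noteq> 0" using that by simp
        from integrable_dominated[OF d x this V]
        have i: "integrable (?L t \<bind> (\<lambda>y. kern P (b y) y)) ?V" by simp
        have "integrable (kern P (b y) y) ?V" if "y \<in> space (?L t)" for y
          using integrable_kern[OF _ \<open>\<beta> \<noteq> 0\<close> V] that by (simp add: state_law(3)[OF d x])
        from integral_bind_integrable[OF state_law_Suc_measurable[OF d x] ne i this] show ?thesis by simp
      qed
      then show "integrable (?L t) (\<lambda>y. \<beta> * ?KV y)" "(\<integral>y. \<beta> * ?KV y \<partial>?L t) = \<beta> * (\<integral>y. ?V y \<partial>?L (Suc t))"
        by (cases "\<beta> = 0", simp, simp del: state_law.simps)+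
    qed
    note iV = integrable_dominated[OF d x nz V] and iq = integrable_dominated[OF d x nz qb]
    have "(\<integral>y. switch_gain q b b' y \<partial>?L t) = (\<integral>y. q y (b y) + \<beta> * ?KV y - ?V y \<partial>?L t)"
      by (rule Bochner_Integration.integral_cong[OF refl])
         (simp add: switch_gain_eq[OF b' q] state_law(3)[OF d x])
    also have "\<dots> = (\<integral>y. q y (b y) \<partial>?L t) + \<beta> * (\<integral>y. ?V y \<partial>?L (Suc t)) - (\<integral>y. ?V y \<partial>?L t)"
      using iV iq KV by (simp del: state_law.simps)
    finally have eq: "(\<integral>y. switch_gain q b b' y \<partial>?L t) =
        (\<integral>y. q y (b y) \<partial>?L t) + \<beta> * (\<integral>y. ?V y \<partial>?L (Suc t)) - (\<integral>y. ?V y \<partial>?L t)" .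
    show ?thesis
      unfolding eq by (simp add: algebra_simps del: state_law.simps)
  qed
  have "?a \<longlonglongrightarrow> 0"
  proof (rule Lim_null_comparison)
    show "\<forall>\<^sub>F t in sequentially. norm (?a t) \<le> C / (1 - \<gamma>) * w x * \<gamma> ^ t"
      using integral_dominated_le[OF d x V] by (intro always_eventually) simp
    show "(\<lambda>t. C / (1 - \<gamma>) * w x * \<gamma> ^ t) \<longlonglongrightarrow> 0"
      using sums_summable[OF geometric_\<gamma>] by (rule summable_LIMSEQ_zero)
  qed
  from telescope_sums[OF this] have tel: "(\<lambda>t. ?a (Suc t) - ?a t) sums (0 - ?a 0)" .
  have V_meas: "?V \<in> borel_measurable S" using V by (simp add: dominated_def)
  have "?a 0 = ?V x"
    using x V_meas by (simp add: integral_return space_state_space)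
  moreover have "?r sums val P q ?d x"
    unfolding val_def using val_summable(1)[OF d x q] by (rule summable_sums)
  ultimately show ?thesis
    using sums_add[OF _ tel, of ?r "val P q ?d x"] unfolding term_eq by simp
qed

text \<open>The performance difference is taken along the limit rule \<open>b\<close>, so the state
  laws stay fixed and only the integrand varies with \<open>n\<close>. It vanishes eventually at
  each state, and dominated convergence applies.\<close>

lemma val_tendsto:
  assumes b: "Measurable.pred S b" and b': "\<And>n. Measurable.pred S (b' n)" and q: "cost C q" and x: "x \<in> X"
    and ev: "\<And>y. y \<in> X \<Longrightarrow> \<forall>\<^sub>F n in sequentially. b' n y = b y"
  shows "(\<lambda>n. val P q (\<lambda>_. b' n) x) \<longlonglongrightarrow> val P q (\<lambda>_. b) x"
proof -
  let ?d = "\<lambda>_::nat. b"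
  let ?L = "state_law P ?d x"
  have d: "rule_measurable ?d" using b by auto
  let ?a = "\<lambda>t n. \<beta> ^ t * (\<integral>y. switch_gain q b (b' n) y \<partial>?L t)"
  let ?C = "2 * C / (1 - \<gamma>)"
  note dom = dominated_switch_gain[OF b b' q]
  have lim: "(\<lambda>n. ?a t n) \<longlonglongrightarrow> 0" for t
  proof (cases "\<beta> ^ t = 0")
    case True
    then show ?thesis by (simp only: mult_zero_left tendsto_const)
  next
    case nz: False
    have "(\<lambda>n. \<integral>y. switch_gain q b (b' n) y \<partial>?L t) \<longlonglongrightarrow> (\<integral>y. 0 \<partial>?L t)"
    proof (rule integral_dominated_convergence)
      show "integrable (?L t) (\<lambda>y. ?C * w y)"
        using integrable_w(1)[OF d x nz] by simp
      show "switch_gain q b (b' n) \<in> borel_measurable (?L t)" for n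
        using borel_measurable_integrable[OF integrable_dominated[OF d x nz dom]] .
      show "AE y in ?L t. norm (switch_gain q b (b' n) y) \<le> ?C * w y" for n
        using dom[of n] by (intro AE_I2) (simp add: dominated_def state_law(3)[OF d x])
      show "AE y in ?L t. (\<lambda>n. switch_gain q b (b' n) y) \<longlonglongrightarrow> 0"
      proof (rule AE_I2)
        fix y assume "y \<in> space (?L t)"
        then have "y \<in> X" by (simp add: state_law(3)[OF d x])
        from ev[OF this] have "\<forall>\<^sub>F n in sequentially. switch_gain q b (b' n) y = 0"
          by eventually_elim (simp add: switch_gain_def)
        then show "(\<lambda>n. switch_gain q b (b' n) y) \<longlonglongrightarrow> 0" by (rule tendsto_eventually)
      qed
    qed simp
    from tendsto_mult_left[OF this, of "\<beta> ^ t"] show ?thesis by simp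
  qed
  \<comment> \<open>Tannery's theorem with the geometric majorant moves the limit inside the sum
    over time.\<close>
  have "(\<lambda>n. \<Sum>t. ?a t n) \<longlonglongrightarrow> (\<Sum>t. 0)"
  proof (rule tannerys_theorem[OF lim _ sums_summable[OF geometric_\<gamma>], THEN conjunct2, THEN conjunct2])
    have "norm (?a t n) \<le> ?C * w x * \<gamma> ^ t" for t n
      using integral_dominated_le[OF d x dom] by simp
    then show "\<forall>\<^sub>F (t, n) in sequentially \<times>\<^sub>F sequentially. norm (?a t n) \<le> ?C * w x * \<gamma> ^ t"
      by (intro always_eventually) (simp add: split_def)
  qed simp
  then have "(\<lambda>n. val P q ?d x - val P q (\<lambda>_. b' n) x) \<longlonglongrightarrow> 0"
    using sums_unique[OF performance_difference[OF b b' q x]] by simp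
  from tendsto_diff[OF tendsto_const[of "val P q ?d x"] this] show ?thesis by simp
qed

subsection \<open>Threshold policies\<close>

abbreviation threshold_val :: "(real \<Rightarrow> bool \<Rightarrow> real) \<Rightarrow> real \<Rightarrow> real \<Rightarrow> real" where
  "threshold_val q x z \<equiv> val P q (\<lambda>_ y. z < y) x"

lemma pred_threshold: "Measurable.pred S (\<lambda>y. z < y)" "Measurable.pred S (\<lambda>y. z \<le> y)"
proof -
  note measurable_ident_state_space[measurable]
  show "Measurable.pred S (\<lambda>y. z < y)" "Measurable.pred S (\<lambda>y. z \<le> y)" by measurable
qed

lemma cost_reward: "cost M (reward P)"
proof -
  have "continuous_on X (\<lambda>x. reward P x a)" for a
    using wf by (simp add: wf_project_def)
  then show ?thesis
    using cost_le M_pos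
    by (auto simp: cost_def dominated_def state_space_def intro!: borel_measurable_continuous_on_restrict)
qed

lemma cost_consumption: "cost M (consumption P)"
proof -
  have "continuous_on X (\<lambda>x. consumption P x a)" for a
    using wf by (simp add: wf_project_def)
  \<comment> \<open>The growth condition bounds consumption only from above; nonnegativity turns
    this into a bound on the absolute value.\<close>
  moreover have "0 \<le> consumption P x a" if "x \<in> X" for x a
    using wf that by (cases a) (auto simp: wf_project_def intro: less_imp_le le_less_trans)
  ultimately show ?thesis
    using cost_le M_pos
    by (auto simp: cost_def dominated_def state_space_def intro!: borel_measurable_continuous_on_restrict)
qed

lemma metric_markov:
  assumes "rule_measurable d" "x \<in> X"
  shows "metric_F P x (markov d) = val P (reward P) d x"
    and "metric_G P x (markov d) = val P (consumption P) d x"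
  using law_integral[OF assms cost_reward] law_integral[OF assms cost_consumption]
  by (simp_all add: metric_F_def metric_G_def)

lemma metric_threshold:
  assumes "x \<in> X"
  shows "metric_F P x (threshold (ereal z)) = threshold_val (reward P) x z"
    and "metric_G P x (threshold (ereal z)) = threshold_val (consumption P) x z"
  using metric_markov[of "\<lambda>_ y. z < y" x] assms pred_threshold by (simp_all add: threshold_eq_markov)

lemma marginal_threshold:
  assumes "x \<in> X"
  shows "marginal_f P x (threshold (ereal z)) = advantage P (reward P) (\<lambda>y. z < y) x"
    and "marginal_g P x (threshold (ereal z)) = advantage P (consumption P) (\<lambda>y. z < y) x"
  using metric_markov[OF rule_measurable_case_nat[of "\<lambda>_ y. z < y"] assms] pred_threshold
  by (simp_all add: marginal_f_def marginal_g_def advantage_def threshold_eq_markov first_then_markov)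

lemma advantage_consumption_pos:
  assumes "PCLI1 P" "x \<in> X"
  shows "0 < advantage P (consumption P) (\<lambda>y. z < y) x"
  using assms unfolding PCLI1_def marginal_threshold(2)[OF assms(2), symmetric] by blast

lemma switch_gain_threshold:
  assumes "z1 \<le> z2"
  shows "switch_gain q (\<lambda>y. z1 < y) (\<lambda>y. z2 < y) y =
    (if z1 < y \<and> y \<le> z2 then advantage P q (\<lambda>y. z2 < y) y else 0)"
  using assms by (auto simp: switch_gain_def)

text \<open>The rules disagree only where the lower threshold is active and the higher one passive,
  and there the advantage is positive by PCLI1. So every term of the performance difference is
  nonnegative.\<close>

lemma threshold_val_antimono:
  assumes "PCLI1 P" "x \<in> X" "z1 \<le> z2"
  shows "threshold_val (consumption P) x z2 \<le> threshold_val (consumption P) x z1"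
proof -
  let ?L = "state_law P (\<lambda>_ y. z1 < y) x"
  have d: "rule_measurable (\<lambda>_ y. z1 < y)" using pred_threshold by simp
  note sums = performance_difference[OF pred_threshold(1)[of z1] pred_threshold(1)[of z2] cost_consumption assms(2)]
  have "0 \<le> \<beta> ^ t * (\<integral>y. switch_gain (consumption P) (\<lambda>y. z1 < y) (\<lambda>y. z2 < y) y \<partial>?L t)" for t
    using advantage_consumption_pos[OF assms(1), of _ z2] \<beta>_nonneg
    by (intro mult_nonneg_nonneg integral_nonneg_AE AE_I2)
       (auto simp: switch_gain_threshold[OF assms(3)] state_law(3)[OF d assms(2)] less_imp_le)
  from sums_le[OF this sums_zero sums] show ?thesis by simp
qed

text \<open>Every term of the performance difference vanishes, whatever \<open>q\<close> is. This
  transfers equality from consumption to reward, and under condition B allows thresholds to be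
  moved.\<close>

lemma threshold_val_eq_if_unvisited:
  assumes "x \<in> X" "z1 \<le> z2" and q: "cost C q"
    and AE: "\<And>t. \<beta> ^ t \<noteq> 0 \<Longrightarrow> AE y in state_law P (\<lambda>_ y. z1 < y) x t. \<not> (z1 < y \<and> y \<le> z2)"
  shows "threshold_val q x z1 = threshold_val q x z2"
proof -
  let ?L = "state_law P (\<lambda>_ y. z1 < y) x"
  have "\<beta> ^ t * (\<integral>y. switch_gain q (\<lambda>y. z1 < y) (\<lambda>y. z2 < y) y \<partial>?L t) = 0" for t
  proof (cases "\<beta> ^ t = 0")
    case False
    from AE[OF this] have "(\<integral>y. switch_gain q (\<lambda>y. z1 < y) (\<lambda>y. z2 < y) y \<partial>?L t) = 0"
      by (intro integral_eq_zero_AE) (auto simp: switch_gain_threshold[OF assms(2)] elim: eventually_mono)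
    then show ?thesis by (simp only: mult_zero_right)
  qed (simp only: mult_zero_left)
  note zero = this
  have "(\<lambda>t::nat. 0) sums (threshold_val q x z1 - threshold_val q x z2)"
    using performance_difference[OF pred_threshold(1)[of z1] pred_threshold(1)[of z2] q assms(1)]
    unfolding zero .
  from sums_unique2[OF sums_zero this] show ?thesis by simp
qed

text \<open>Since the consumption advantage is positive, equal consumption forces the process never to
  visit the states on which the two thresholds disagree.\<close>

lemma threshold_val_eq:
  assumes "PCLI1 P" "x \<in> X" and le: "z1 \<le> z2" and q: "cost C q"
    and eq: "threshold_val (consumption P) x z1 = threshold_val (consumption P) x z2"
  shows "threshold_val q x z1 = threshold_val q x z2"
proof (rule threshold_val_eq_if_unvisited[OF assms(2) le q])
  let ?L = "state_law P (\<lambda>_ y. z1 < y) x"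
  let ?g = "switch_gain (consumption P) (\<lambda>y. z1 < y) (\<lambda>y. z2 < y)"
  have d: "rule_measurable (\<lambda>_ y. z1 < y)" using pred_threshold by simp
  fix t assume nz: "\<beta> ^ t \<noteq> 0"
  have AE_nn: "AE y in ?L t. 0 \<le> ?g y" for t
    using advantage_consumption_pos[OF assms(1), of _ z2]
    by (intro AE_I2) (auto simp: switch_gain_threshold[OF le] state_law(3)[OF d assms(2)] less_imp_le)
  have nn: "0 \<le> \<beta> ^ t * (\<integral>y. ?g y \<partial>?L t)" for t
    by (intro mult_nonneg_nonneg integral_nonneg_AE AE_nn zero_le_power \<beta>_nonneg)
  have "(\<lambda>t. \<beta> ^ t * (\<integral>y. ?g y \<partial>?L t)) sums 0"
    using performance_difference[OF pred_threshold(1)[of z1] pred_threshold(1)[of z2] cost_consumption assms(2)] eq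
    by simp
  \<comment> \<open>A nonnegative series with sum zero has only zero terms; each integrand is
    nonnegative too, hence zero almost everywhere.\<close>
  from suminf_eq_zero_iff[OF sums_summable[OF this] nn] sums_unique[OF this]
  have "\<beta> ^ t * (\<integral>y. ?g y \<partial>?L t) = 0" by simp
  with nz have "(\<integral>y. ?g y \<partial>?L t) = 0" by (simp only: mult_eq_0_iff) blast
  moreover have "integrable (?L t) ?g"
    by (rule integrable_dominated[OF d assms(2) nz dominated_switch_gain[OF pred_threshold(1) pred_threshold(1) cost_consumption]])
  ultimately have "AE y in ?L t. ?g y = 0"
    using AE_nn[of t] by (simp add: integral_nonneg_eq_0_iff_AE)
  then show "AE y in ?L t. \<not> (z1 < y \<and> y \<le> z2)"
    using AE_space
  proof eventually_elim
    fix y assume "?g y = 0" "y \<in> space (?L t)"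
    then show "\<not> (z1 < y \<and> y \<le> z2)"
      using advantage_consumption_pos[OF assms(1), of y z2]
      by (auto simp: switch_gain_threshold[OF le] state_law(3)[OF d assms(2)])
  qed
qed

text \<open>If thresholds approach \<open>z\<close> from above, a state beyond \<open>z\<close>
  eventually exceeds them and a state at most \<open>z\<close> never does. The rules thus converge
  pointwise to the strict threshold rule at \<open>z\<close>.\<close>

lemma threshold_val_right_continuous:
  assumes x: "x \<in> X" and q: "cost C q"
  shows "continuous (at_right z) (threshold_val q x)"
  unfolding continuous_within tendsto_at_iff_sequentially comp_def
proof (intro allI impI)
  fix Z :: "nat \<Rightarrow> real" assume Z: "\<forall>i. Z i \<in> {z<..} - {z}" "Z \<longlonglongrightarrow> z"
  show "(\<lambda>n. threshold_val q x (Z n)) \<longlonglongrightarrow> threshold_val q x z"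
  proof (rule val_tendsto[OF pred_threshold(1) pred_threshold(1) q x])
    fix y
    show "\<forall>\<^sub>F n in sequentially. (Z n < y) = (z < y)"
    proof (cases "z < y")
      case True
      from order_tendstoD(2)[OF Z(2) this] show ?thesis by eventually_elim (use True in simp)
    next
      case False
      then have "\<not> Z n < y" for n using Z(1)[rule_format, of n] by simp
      with False show ?thesis by simp
    qed
  qed
qed

text \<open>The left limit is the value of the policy that is active on \<open>{z..}\<close>.  It exceeds the
  value at \<open>z\<close> by a multiple of the advantage at the single state \<open>z\<close>.\<close>

lemma isCont_threshold_val:
  assumes x: "x \<in> X" and q: "cost C q" and adv: "z \<in> X \<Longrightarrow> advantage P q (\<lambda>y. z < y) z = 0"
  shows "isCont (threshold_val q x) z"
  unfolding continuous_at_split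
proof
  \<comment> \<open>The two rules disagree at the state \<open>z\<close> alone, where
    \<open>adv\<close> makes the advantage vanish.\<close>
  have zero: "switch_gain q (\<lambda>y. z \<le> y) (\<lambda>y. z < y) y = 0" if "y \<in> X" for y
    using adv that by (cases "y = z") (auto simp: switch_gain_def)
  have d: "rule_measurable (\<lambda>_ y. z \<le> y)" using pred_threshold by simp
  have "(\<integral>y. switch_gain q (\<lambda>y. z \<le> y) (\<lambda>y. z < y) y \<partial>state_law P (\<lambda>_ y. z \<le> y) x t) = 0" for t
    by (intro integral_eq_zero_AE AE_I2) (simp add: zero state_law(3)[OF d x])
  then have "(\<lambda>t::nat. 0) sums (val P q (\<lambda>_ y. z \<le> y) x - threshold_val q x z)"
    using performance_difference[OF pred_threshold(2)[of z] pred_threshold(1)[of z] q x] by simp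
  from sums_unique2[OF sums_zero this] have eq: "val P q (\<lambda>_ y. z \<le> y) x = threshold_val q x z"
    by simp
  show "continuous (at_left z) (threshold_val q x)"
    unfolding continuous_within tendsto_at_iff_sequentially comp_def
  proof (intro allI impI)
    fix Z :: "nat \<Rightarrow> real" assume Z: "\<forall>i. Z i \<in> {..<z} - {z}" "Z \<longlonglongrightarrow> z"
    show "(\<lambda>n. threshold_val q x (Z n)) \<longlonglongrightarrow> threshold_val q x z"
      unfolding eq[symmetric]
    proof (rule val_tendsto[OF pred_threshold(2) pred_threshold(1) q x])
      fix y
      show "\<forall>\<^sub>F n in sequentially. (Z n < y) = (z \<le> y)"
      proof (cases "z \<le> y")
        case True
        then have "Z n < y" for n using Z(1)[rule_format, of n] by simp
        with True show ?thesis by simp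
      next
        case False
        then have "y < z" by simp
        from order_tendstoD(1)[OF Z(2) this] show ?thesis by eventually_elim (use False in simp)
      qed
    qed
  qed
qed (rule threshold_val_right_continuous[OF x q])

section \<open>Net reward at a resource price\<close>

lemma cost_net:
  assumes "cost C q" "cost C' q'"
  shows "cost (C + \<bar>\<mu>\<bar> * C') (\<lambda>y a. q y a - \<mu> * q' y a)"
proof -
  have "\<bar>q y a - \<mu> * q' y a\<bar> \<le> (C + \<bar>\<mu>\<bar> * C') * w y" if "y \<in> X" for y a
  proof -
    have "\<bar>q y a - \<mu> * q' y a\<bar> \<le> \<bar>q y a\<bar> + \<bar>\<mu>\<bar> * \<bar>q' y a\<bar>"
      by (metis abs_mult abs_triangle_ineq4)
    also have "\<dots> \<le> C * w y + \<bar>\<mu>\<bar> * (C' * w y)"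
      using assms that by (intro add_mono mult_left_mono) (auto simp: cost_def dominated_def)
    finally show ?thesis by (simp add: algebra_simps)
  qed
  then show ?thesis
    using assms by (auto simp: cost_def dominated_def intro!: borel_measurable_diff borel_measurable_times)
qed

lemma val_net:
  assumes d: "rule_measurable d" and x: "x \<in> X" and q: "cost C q" and q': "cost C' q'"
  shows "val P (\<lambda>y a. q y a - \<mu> * q' y a) d x = val P q d x - \<mu> * val P q' d x"
proof -
  let ?L = "state_law P d x"
  have "\<beta> ^ t * (\<integral>y. q y (d t y) - \<mu> * q' y (d t y) \<partial>?L t) =
      \<beta> ^ t * (\<integral>y. q y (d t y) \<partial>?L t) - \<mu> * (\<beta> ^ t * (\<integral>y. q' y (d t y) \<partial>?L t))" for t
  \<comment> \<open>Splitting the integral requires integrability, which is available only when the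
    discount power is nonzero.\<close>
  proof (cases "\<beta> ^ t = 0")
    case True
    then show ?thesis by (simp only: mult_zero_left mult_zero_right diff_self)
  next
    case nz: False
    have "integrable (?L t) (\<lambda>y. q y (d t y))" "integrable (?L t) (\<lambda>y. q' y (d t y))"
      using integrable_dominated[OF d x nz cost_rule[OF q]] integrable_dominated[OF d x nz cost_rule[OF q']] d
      by auto
    then show ?thesis by (simp add: algebra_simps)
  qed
  note net = this and s = val_summable(1)[OF d x q] and s' = val_summable(1)[OF d x q']
  show ?thesis
    unfolding val_def net suminf_diff[OF s summable_mult[OF s'], symmetric] suminf_mult[OF s'] ..
qed

text \<open>At the price \<open>mp_index_ext P z\<close> the marginal reward at \<open>z\<close>
  equals the priced marginal consumption, so the net advantage there is zero and no jump remains. If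
  \<open>z\<close> is not a state, there is nothing to verify.\<close>

lemma isCont_net_threshold_val:
  assumes P1: "PCLI1 P" and x: "x \<in> X"
  shows "isCont (\<lambda>y. threshold_val (reward P) x y - mp_index_ext P z * threshold_val (consumption P) x y) z"
proof -
  let ?\<mu> = "mp_index_ext P z"
  let ?q = "\<lambda>y a. reward P y a - ?\<mu> * consumption P y a"
  note q = cost_net[OF cost_reward cost_consumption, of ?\<mu>]
  have "isCont (threshold_val ?q x) z"
  proof (rule isCont_threshold_val[OF x q])
    assume z: "z \<in> X"
    then have "?\<mu> = mp_index P z" by (auto simp: mp_index_ext_def states_def)
    then have adv: "?\<mu> * advantage P (consumption P) (\<lambda>y. z < y) z = advantage P (reward P) (\<lambda>y. z < y) z"
      using advantage_consumption_pos[OF P1 z, of z] by (simp add: mp_index_def marginal_threshold[OF z])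
    have net: "val P ?q (case_nat (\<lambda>_. a) (\<lambda>_ y. z < y)) z =
        val P (reward P) (case_nat (\<lambda>_. a) (\<lambda>_ y. z < y)) z - ?\<mu> * val P (consumption P) (case_nat (\<lambda>_. a) (\<lambda>_ y. z < y)) z" for a
      by (rule val_net[OF rule_measurable_case_nat z cost_reward cost_consumption]) (simp add: pred_threshold)
    show "advantage P ?q (\<lambda>y. z < y) z = 0"
      using adv unfolding advantage_def net right_diff_distrib by linarith
  qed
  moreover have "threshold_val ?q x y = threshold_val (reward P) x y - ?\<mu> * threshold_val (consumption P) x y" for y
    by (rule val_net[OF _ x cost_reward cost_consumption]) (simp add: pred_threshold)
  ultimately show ?thesis by (simp only:)
qed

section \<open>Countable range of the consumption value\<close>

text \<open>Only the cell containing \<open>z\<close> contributes to the sum, so every value is one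
  of the countably many coefficients.\<close>

lemma countable_range_cond_A:
  assumes A: "cond_A P" and x: "x \<in> X"
  shows "countable (range (threshold_val (consumption P) x))"
proof -
  from bspec[OF A[unfolded cond_A_def] x]
  obtain \<S> and v :: "real set \<Rightarrow> real" where \<S>: "countable \<S>" "lsc_partition \<S>"
    and sum: "\<And>z. ((\<lambda>S. v S * indicator S z) has_sum threshold_val (consumption P) x z) \<S>"
    unfolding metric_threshold(2)[OF x] by blast
  have "threshold_val (consumption P) x z \<in> v ` \<S>" for z
  proof -
    have part: "partition_on UNIV \<S>" using \<S>(2) by (simp add: lsc_partition_def)
    then obtain S0 where S0: "S0 \<in> \<S>" "z \<in> S0" by (auto simp: partition_on_def)
    have "z \<notin> T" if "T \<in> \<S> - {S0}" for T
      using partition_onD2[OF part] S0 that by (auto simp: disjoint_def)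
    then have "((\<lambda>S. v S * indicator S z) has_sum v S0) \<S>"
      using S0 by (intro has_sum_finite_neutralI[where B="{S0}"]) auto
    from has_sum_unique[OF sum this] S0(1) show ?thesis by auto
  qed
  then have "range (threshold_val (consumption P) x) \<subseteq> v ` \<S>" by auto
  then show ?thesis using \<S>(1) by (meson countable_image countable_subset)
qed

text \<open>A threshold outside \<open>D\<close> can be raised to a rational in the same cell
  without passing a state that the process visits. All values are therefore attained at thresholds
  in \<open>D\<close> or in the rationals.\<close>

lemma countable_range_cond_B:
  assumes B: "cond_B P" and x: "x \<in> X"
  shows "countable (range (threshold_val (consumption P) x))"
proof -
  let ?G = "threshold_val (consumption P) x"
  from bspec[OF B[unfolded cond_B_def] x] obtain D \<S> where D: "countable D" "D = endpoints \<S>"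
    and one: "\<And>z. \<P>(\<omega> in law P x (threshold z). \<forall>t. fst (\<omega> t) \<in> D) = 1"
    by (elim exE conjE) blast
  have AE: "AE y in state_law P (\<lambda>_ y. z < y) x t. y \<in> D" for z t
  proof -
    have d: "rule_measurable (\<lambda>_ y. z < y)" using pred_threshold by simp
    interpret prob_space "law P x (markov (\<lambda>_ y. z < y))" by (rule prob_space_law[OF d x])
    have "AE \<omega> in law P x (markov (\<lambda>_ y. z < y)). fst (\<omega> t) \<in> D"
      using AE_prob_1[OF one[of "ereal z", unfolded threshold_eq_markov ereal_less_eq less_ereal.simps]]
      by eventually_elim simp
    moreover have "D \<in> sets borel" by (rule sets.countable[OF _ D(1)]) simp
    ultimately show ?thesis by (intro AE_law_component[OF d x])
  qed
  have "?G z \<in> ?G ` (D \<union> \<rat>)" for z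
  proof (cases "z \<in> D")
    case False
    then obtain T where T: "T \<in> \<S>" "z \<in> interior T" by (auto simp: D(2) endpoints_def)
    then obtain e where e: "0 < e" "ball z e \<subseteq> interior T"
      using open_contains_ball open_interior by blast
    obtain r where r: "r \<in> \<rat>" "z < r" "r < z + e"
      using Rats_dense_in_real[of z "z + e"] e(1) by auto
    \<comment> \<open>\<open>{z<..r}\<close> lies in a ball inside the interior of the cell
      \<open>T\<close>, while endpoints avoid all interiors.\<close>
    have off: "y \<notin> D" if "z < y" "y \<le> r" for y
    proof -
      have "y \<in> ball z e" using that r by (simp add: dist_real_def)
      then show ?thesis using e(2) T(1) by (auto simp: D(2) endpoints_def)
    qed
    have "?G z = ?G r"
    proof (rule threshold_val_eq_if_unvisited[OF x _ cost_consumption])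
      show "AE y in state_law P (\<lambda>_ y. z < y) x t. \<not> (z < y \<and> y \<le> r)" for t
        using AE[of z t] by eventually_elim (use off in blast)
    qed (use r in simp)
    with r(1) show ?thesis by blast
  qed simp
  then have "range ?G \<subseteq> ?G ` (D \<union> \<rat>)" by auto
  then show ?thesis
    using D(1) countable_rat by (meson countable_Un countable_image countable_subset)
qed

end

section \<open>The extended index and the final assembly\<close>

text \<open>The extension is the index composed with the retraction of the line onto the state
  interval, which is monotone and continuous.\<close>

lemma mp_index_ext_mono_continuous:
  assumes "lo P < hi P" and P2: "PCLI2 P"
  shows "mono (mp_index_ext P)" "isCont (mp_index_ext P) z"
proof -
  \<comment> \<open>At an infinite end \<open>real_of_ereal\<close> would return 0, but no real lies
    beyond that end, so the branch is never taken.\<close>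
  define cl where "cl z = (if ereal z < lo P then real_of_ereal (lo P)
    else if hi P < ereal z then real_of_ereal (hi P) else z)" for z
  have ext: "mp_index_ext P = (\<lambda>z. mp_index P (cl z))"
    by (auto simp: fun_eq_iff mp_index_ext_def cl_def)
  have cl: "mono cl \<and> range cl \<subseteq> states P \<and> continuous_on UNIV cl"
  proof (cases "lo P"; cases "hi P")
    fix l h assume lh: "lo P = ereal l" "hi P = ereal h"
    then have "cl = (\<lambda>z. max l (min h z))" using assms(1) by (auto simp: cl_def fun_eq_iff)
    then show ?thesis using lh assms(1) by (auto simp: states_def intro!: monoI continuous_intros)
  next
    fix l assume lh: "lo P = ereal l" "hi P = \<infinity>"
    then have "cl = (\<lambda>z. max l z)" by (auto simp: cl_def fun_eq_iff)
    then show ?thesis using lh by (auto simp: states_def intro!: monoI continuous_intros)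
  next
    fix h assume lh: "lo P = - \<infinity>" "hi P = ereal h"
    then have "cl = (\<lambda>z. min h z)" by (auto simp: cl_def fun_eq_iff)
    then show ?thesis using lh by (auto simp: states_def intro!: monoI continuous_intros)
  next
    assume lh: "lo P = - \<infinity>" "hi P = \<infinity>"
    then have "cl = (\<lambda>z. z)" by (auto simp: cl_def fun_eq_iff)
    then show ?thesis using lh by (auto simp: states_def intro!: monoI continuous_intros)
  qed (use assms(1) in auto)
  show "mono (mp_index_ext P)"
  proof (rule monoI)
    fix x y :: real assume "x \<le> y"
    then show "mp_index_ext P x \<le> mp_index_ext P y"
      using cl P2 unfolding ext PCLI2_def by (intro mono_onD[of "states P" "mp_index P"]) (auto dest: monoD)
  qed
  have "continuous_on UNIV (mp_index_ext P)"
    unfolding ext using cl P2 by (intro continuous_on_compose2[of "states P" "mp_index P" UNIV cl]) (auto simp: PCLI2_def)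
  then show "isCont (mp_index_ext P) z"
    by (simp add: continuous_on_eq_continuous_at)
qed

theorem proposition6:
  fixes P :: bandit_project
  assumes "wf_project P"
    and "PCLI1 P"
    and "PCLI2 P"
    and "cond_A P \<or> cond_B P"
  shows "\<forall>x\<in>states P. \<forall>z1 z2 :: real. z1 < z2 \<longrightarrow>
           has_LS_integral (mp_index_ext P) (\<lambda>z. metric_G P x (threshold (ereal z))) {z1<..z2}
             (metric_F P x (threshold (ereal z2)) - metric_F P x (threshold (ereal z1)))"
proof (intro ballI allI impI)
  fix x and z1 z2 :: real assume x: "x \<in> states P" and z: "z1 < z2"
  obtain w M \<gamma> where "weighted_project P w M \<gamma>"
  proof -
    from assms(1)[unfolded wf_project_def] obtain w :: "real \<Rightarrow> real" and M \<gamma> where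
      "w \<in> borel_measurable (state_space P)" "\<forall>x\<in>states P. 1 \<le> w x" "0 < M" "disc P \<le> \<gamma>" "\<gamma> < 1"
      "\<forall>x\<in>states P. \<forall>a. max \<bar>reward P x a\<bar> (consumption P x a) \<le> M * w x \<and>
         ennreal (disc P) * (\<integral>\<^sup>+ y. ennreal (w y) \<partial>kern P a x) \<le> ennreal (\<gamma> * w x)"
      by (elim conjE exE) (rule that)
    with assms(1) have "weighted_project P w M \<gamma>"
      by (intro weighted_project.intro) blast+
    then show ?thesis by (rule that)
  qed
  then interpret weighted_project P w M \<gamma> .
  let ?F = "threshold_val (reward P) x" and ?H = "\<lambda>z. - threshold_val (consumption P) x z"
  let ?\<phi> = "mp_index_ext P"
  have H: "mono ?H" "continuous (at_right z) ?H" for z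
    using threshold_val_antimono[OF assms(2) x] threshold_val_right_continuous[OF x cost_consumption]
    by (auto intro!: monoI continuous_minus)
  have "lo P < hi P" using assms(1) by (simp add: wf_project_def)
  note \<phi> = mp_index_ext_mono_continuous[OF this assms(3)]
  have count: "countable (range ?H)"
  proof -
    have "countable (range (threshold_val (consumption P) x))"
      using assms(4) countable_range_cond_A[OF _ x] countable_range_cond_B[OF _ x] by blast
    from countable_image[OF this, of uminus] show ?thesis by (simp add: image_image)
  qed
  \<comment> \<open>Equal consumption forces equal reward for ordered thresholds; symmetry covers
    the other order.\<close>
  have HF: "?F a = ?F b" if "?H a = ?H b" for a b
    using threshold_val_eq[OF assms(2) x _ cost_reward] that by (metis linear neg_equal_iff_equal)
  have cont: "isCont (\<lambda>y. ?F y + ?\<phi> z * ?H y) z" for z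
    using isCont_net_threshold_val[OF assms(2) x, of z] by simp
  have int: "?F z2 - ?F z1 = - (LINT z:{z1<..z2}|interval_measure ?H. ?\<phi> z)"
    using z by (intro interval_measure_integral_countable_range H \<phi> cont count HF) auto
  have zero: "mono (\<lambda>_. 0 :: real)" "continuous (at_right z) (\<lambda>_. 0 :: real)" for z :: real
    by (auto intro: monoI)
  note rem0 = interval_measure_integral_bounds[OF zero \<phi>(1) less_imp_le[OF z]]
  note rem = interval_measure_integral_bounds(1)[OF H \<phi>(1) less_imp_le[OF z]]
  \<comment> \<open>The consumption value is nonincreasing, so it is decomposed as
    \<open>0 - ?H\<close>: the positive part is the zero function, and its integral vanishes by the
    two bounds.\<close>
  have "(LINT z:{z1<..z2}|interval_measure (\<lambda>_. 0). ?\<phi> z) = 0" using rem0(2,3) by simp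
  then show "has_LS_integral ?\<phi> (\<lambda>z. metric_G P x (threshold (ereal z))) {z1<..z2}
      (metric_F P x (threshold (ereal z2)) - metric_F P x (threshold (ereal z1)))"
    unfolding has_LS_integral_def metric_threshold[OF x]
    by (intro exI[of _ "\<lambda>_. 0"] exI[of _ ?H]) (use zero H rem0(1) rem int in auto)
qed

end
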